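(* Let $F,\phi:\mathcal X\to\mathbb R\cup\{+\infty\}$ be proper lower semicontinuous functions such that $\inf_{x\in\mathcal X}(F+\phi)(x)>-\infty$; $F$ is locally Lipschitz continuous at every point of $\operatorname{int}(\operatorname{dom}F)$; $\operatorname{dom}F$ is convex with $\operatorname{dom}\phi\subset\operatorname{int}(\operatorname{dom}F)$; and $\phi$ is prox-bounded with threshold $\gamma_\phi\in(0,+\infty]$. For $x^\star\in\operatorname{dom}\phi$ consider the conditions: (i) $x^\star$ is a critical point of $F+\phi$, i.e., $\mathcal M_{\gamma_{x^\star}}^{F,\phi}(x^\star)=0$ holds with some $\gamma_{x^\star}\in(0,\gamma_\phi)$. (ii) There is some $\gamma_{x^\star}\in(0,\gamma_\phi)$ such that $\mathcal M_{\gamma}^{F,\phi}(x^\star)=0$ holds for all $\gamma\in(0,\gamma_{x^\star}]$. Then for every $x^\star\in\operatorname{dom}\phi$: (a) If $F$ is lower regular at every point of $\operatorname{int}(\operatorname{dom}F)$ and $\phi$ is prox-regular at every point of $\operatorname{dom}\phi$, then [$x^\star$ is a Fréchet stationary point of $F+\phi$] $\Leftrightarrow$ (i) $\Leftrightarrow$ (ii). (b) If $F$ is differentiable over $\operatorname{int}(\operatorname{dom}F)$ and $\nabla F:\operatorname{int}(\operatorname{dom}F)\to\mathcal X$ is locally Lipschitz continuous at every point of $\operatorname{int}(\operatorname{dom}F)$, then [$x^\star$ is a proximal stationary point of $F+\phi$] $\Leftrightarrow$ (i) $\Leftrightarrow$ (ii).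
   Context: $\mathcal X$ is a (finite-dimensional real) Euclidean space with inner product $\langle\cdot,\cdot\rangle$ and norm $\|\cdot\|$; $B(\bar x,\delta)$ is the open ball; $\operatorname{dom}\psi=\{x:\psi(x)<+\infty\}$; proper means $\operatorname{dom}\psi\neq\emptyset$; $\operatorname{dist}(\bar x,E)=\inf\{\|v-\bar x\|: v\in E\}$, equal to $+\infty$ if $E=\emptyset$. A function (or mapping) is locally Lipschitz continuous at $\bar x$ if it is Lipschitz continuous on some open neighborhood of $\bar x$. $\phi$ is prox-bounded with threshold $\gamma_\phi\in(0,+\infty]$ if $\phi+\frac1{2\gamma}\|\cdot\|^2$ is bounded below for all $\gamma\in(0,\gamma_\phi)$. Subdifferentials of $\psi:\mathcal X\to\mathbb R\cup\{+\infty\}$ at $\bar x\in\operatorname{dom}\psi$ (all are empty if $\bar x\notin\operatorname{dom}\psi$): - proximal: $v\in\partial_{\rm P}\psi(\bar x)$ if there are $\gamma,\delta>0$ with $\psi(x)\ge\psi(\bar x)+\langle v,x-\bar x\rangle-\frac1{2\gamma}\|x-\bar x\|^2$ for all $x\in B(\bar x,\delta)$; - Fréchet: $v\in\partial_{\rm F}\psi(\bar x)$ if $\liminf_{x\to\bar x,\,x\ne\bar x}\frac{\psi(x)-\psi(\bar x)-\langle v,x-\bar x\rangle}{\|x-\bar x\|}\ge0$; - limiting: $v\in\partial_{\rm L}\psi(\bar x)$ if there are $x_n\to\bar x$ with $\psi(x_n)\to\psi(\bar x)$ and $v_n\in\partial_{\rm F}\psi(x_n)$ with $v_n\to v$. $x^\star\in\operatorname{dom}\phi$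 is a proximal (resp. Fréchet) stationary point of $F+\phi$ if $0\in\partial_{\rm P}(F+\phi)(x^\star)$ (resp. $0\in\partial_{\rm F}(F+\phi)(x^\star)$). $\psi$ is lower regular at $\bar x\in\operatorname{dom}\psi$ if $\partial_{\rm F}\psi(\bar x)=\partial_{\rm L}\psi(\bar x)$. $\psi$ is prox-regular at $\bar x\in\operatorname{dom}\psi$ for $\bar v\in\partial_{\rm L}\psi(\bar x)$ if there are $\delta>0$, $\eta\ge0$ such that $\psi(x')\ge\psi(x)+\langle v,x'-x\rangle-\frac\eta2\|x'-x\|^2$ for all $x'\in B(\bar x,\delta)$ whenever $x\in B(\bar x,\delta)$, $v\in\partial_{\rm L}\psi(x)\cap B(\bar v,\delta)$ and $\psi(x)<\psi(\bar x)+\delta$; $\psi$ is prox-regular at $\bar x$ if this holds for every $\bar v\in\partial_{\rm L}\psi(\bar x)$. For $\gamma>0$, $\operatorname{prox}_{\gamma\phi}(\bar x)=\operatorname{argmin}_{x\in\mathcal X}\big(\phi(x)+\frac1{2\gamma}\|x-\bar x\|^2\big)$ (a set), and the gradient mapping-type stationarity measure is $$\mathcal M_\gamma^{F,\phi}(\bar x)=\inf\Big\{\Big\|\frac{\bar x-p}{\gamma}\Big\| : p\in\operatorname{prox}_{\gamma\phi}(\bar x-\gamma v),\ v\in\partial_{\rm L}F(\bar x)\Big\}\in[0,+\infty]\quad(\inf\emptyset=+\infty).$$ *)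

theory Defs
  imports "HOL-Analysis.Analysis"
begin

text \<open>
  Functions into the reals extended by plus infinity have type
  \<open>'a \<Rightarrow> ereal\<close>; that \<open>-\<infinity>\<close> is not attained is a separate hypothesis wherever it is needed.
\<close>

definition edom :: "('a \<Rightarrow> ereal) \<Rightarrow> 'a set" where
  "edom \<psi> = {x. \<psi> x < \<infinity>}"

definition proper :: "('a \<Rightarrow> ereal) \<Rightarrow> bool" where
  "proper \<psi> \<longleftrightarrow> edom \<psi> \<noteq> {}"

definition lower_semicontinuous :: "('a::topological_space \<Rightarrow> ereal) \<Rightarrow> bool" where
  "lower_semicontinuous \<psi> \<longleftrightarrow> (\<forall>x. \<psi> x \<le> Liminf (at x) \<psi>)"

text \<open>
  Local Lipschitz continuity at \<open>x\<close> of a mapping whose domain of definition is \<open>D\<close>; values of \<open>f\<close>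
  outside \<open>D\<close> are meaningless and hence the neighbourhood has to lie in \<open>D\<close>.
\<close>

definition locally_lipschitz_at ::
    "'a::metric_space set \<Rightarrow> ('a \<Rightarrow> 'b::metric_space) \<Rightarrow> 'a \<Rightarrow> bool" where
  "locally_lipschitz_at D f x \<longleftrightarrow> (\<exists>U L. open U \<and> x \<in> U \<and> U \<subseteq> D \<and> L-lipschitz_on U f)"

text \<open>Meaningful only where \<open>f\<close> is differentiable.\<close>

definition gradient :: "('a::real_inner \<Rightarrow> real) \<Rightarrow> 'a \<Rightarrow> 'a" where
  "gradient f x = (THE D. GDERIV f x :> D)"

text \<open>
  As in the source, \<open>\<gamma>\<^sub>0\<close> is a threshold if boundedness holds below it; it is not required to be
  the largest one.
\<close>

definition prox_bounded :: "('a::real_normed_vector \<Rightarrow> ereal) \<Rightarrow> ereal \<Rightarrow> bool" where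
  "prox_bounded \<phi> \<gamma>\<^sub>0 \<longleftrightarrow>
     0 < \<gamma>\<^sub>0 \<and>
     (\<forall>\<gamma>::real. 0 < \<gamma> \<and> ereal \<gamma> < \<gamma>\<^sub>0 \<longrightarrow>
        (\<exists>c::real. \<forall>x. ereal c \<le> \<phi> x + ereal (1 / (2 * \<gamma>) * (norm x)\<^sup>2)))"

definition proximal_subdiff :: "('a::euclidean_space \<Rightarrow> ereal) \<Rightarrow> 'a \<Rightarrow> 'a set" where
  "proximal_subdiff \<psi> a =
     {v. a \<in> edom \<psi> \<and>
         (\<exists>\<gamma>>0. \<exists>\<delta>>0. \<forall>x\<in>ball a \<delta>.
            \<psi> x \<ge> \<psi> a + ereal (v \<bullet> (x - a) - 1 / (2 * \<gamma>) * (norm (x - a))\<^sup>2))}"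

definition frechet_subdiff :: "('a::euclidean_space \<Rightarrow> ereal) \<Rightarrow> 'a \<Rightarrow> 'a set" where
  "frechet_subdiff \<psi> a =
     {v. a \<in> edom \<psi> \<and>
         Liminf (at a) (\<lambda>x. (\<psi> x - \<psi> a - ereal (v \<bullet> (x - a))) / ereal (norm (x - a))) \<ge> 0}"

definition limiting_subdiff :: "('a::euclidean_space \<Rightarrow> ereal) \<Rightarrow> 'a \<Rightarrow> 'a set" where
  "limiting_subdiff \<psi> a =
     {v. a \<in> edom \<psi> \<and>
         (\<exists>(x :: nat \<Rightarrow> 'a) w.
            x \<longlonglongrightarrow> a \<and> (\<lambda>n. \<psi> (x n)) \<longlonglongrightarrow> \<psi> a \<and>
            (\<forall>n. w n \<in> frechet_subdiff \<psi> (x n)) \<and> w \<longlonglongrightarrow> v)}"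

definition proximal_stationary ::
    "('a::euclidean_space \<Rightarrow> ereal) \<Rightarrow> ('a \<Rightarrow> ereal) \<Rightarrow> 'a \<Rightarrow> bool" where
  "proximal_stationary F \<phi> a \<longleftrightarrow> a \<in> edom \<phi> \<and> 0 \<in> proximal_subdiff (\<lambda>x. F x + \<phi> x) a"

definition frechet_stationary ::
    "('a::euclidean_space \<Rightarrow> ereal) \<Rightarrow> ('a \<Rightarrow> ereal) \<Rightarrow> 'a \<Rightarrow> bool" where
  "frechet_stationary F \<phi> a \<longleftrightarrow> a \<in> edom \<phi> \<and> 0 \<in> frechet_subdiff (\<lambda>x. F x + \<phi> x) a"

definition lower_regular_at :: "('a::euclidean_space \<Rightarrow> ereal) \<Rightarrow> 'a \<Rightarrow> bool" where
  "lower_regular_at \<psi> a \<longleftrightarrow> a \<in> edom \<psi> \<and> frechet_subdiff \<psi> a = limiting_subdiff \<psi> a"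

definition prox_regular_at_for :: "('a::euclidean_space \<Rightarrow> ereal) \<Rightarrow> 'a \<Rightarrow> 'a \<Rightarrow> bool" where
  "prox_regular_at_for \<psi> a b \<longleftrightarrow>
     a \<in> edom \<psi> \<and> b \<in> limiting_subdiff \<psi> a \<and>
     (\<exists>\<delta>>0. \<exists>\<eta>\<ge>0. \<forall>x\<in>ball a \<delta>. \<forall>v\<in>limiting_subdiff \<psi> x \<inter> ball b \<delta>.
        \<psi> x < \<psi> a + ereal \<delta> \<longrightarrow>
        (\<forall>x'\<in>ball a \<delta>. \<psi> x' \<ge> \<psi> x + ereal (v \<bullet> (x' - x) - \<eta> / 2 * (norm (x' - x))\<^sup>2)))"

definition prox_regular_at :: "('a::euclidean_space \<Rightarrow> ereal) \<Rightarrow> 'a \<Rightarrow> bool" where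
  "prox_regular_at \<psi> a \<longleftrightarrow>
     a \<in> edom \<psi> \<and> (\<forall>b\<in>limiting_subdiff \<psi> a. prox_regular_at_for \<psi> a b)"

definition prox :: "real \<Rightarrow> ('a::euclidean_space \<Rightarrow> ereal) \<Rightarrow> 'a \<Rightarrow> 'a set" where
  "prox \<gamma> \<phi> a =
     {p. is_arg_min (\<lambda>x. \<phi> x + ereal (1 / (2 * \<gamma>) * (norm (x - a))\<^sup>2)) (\<lambda>_. True) p}"

text \<open>On \<open>ereal\<close> the infimum of the empty set is \<open>\<infinity>\<close>, as required.\<close>

definition stationarity_measure ::
    "real \<Rightarrow> ('a::euclidean_space \<Rightarrow> ereal) \<Rightarrow> ('a \<Rightarrow> ereal) \<Rightarrow> 'a \<Rightarrow> ereal" where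
  "stationarity_measure \<gamma> F \<phi> a =
     Inf {ereal (norm ((1 / \<gamma>) *\<^sub>R (a - p))) | p v.
            p \<in> prox \<gamma> \<phi> (a - \<gamma> *\<^sub>R v) \<and> v \<in> limiting_subdiff F a}"

definition critical_point ::
    "ereal \<Rightarrow> ('a::euclidean_space \<Rightarrow> ereal) \<Rightarrow> ('a \<Rightarrow> ereal) \<Rightarrow> 'a \<Rightarrow> bool" where
  "critical_point \<gamma>\<^sub>0 F \<phi> a \<longleftrightarrow>
     (\<exists>\<gamma>>0. ereal \<gamma> < \<gamma>\<^sub>0 \<and> stationarity_measure \<gamma> F \<phi> a = 0)"

end

theory Submission
  imports Defs
begin

text \<open>
  Expanding the square in the definition of \<open>prox\<close> shows that \<open>a \<in> prox \<gamma> \<phi> (a - \<gamma> v)\<close> says exactly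
  that \<open>\<phi>\<close> has the global minorant \<open>\<phi> a - v \<bullet> (y - a) - \<parallel>y - a\<parallel>\<^sup>2 / (2 \<gamma>)\<close>. Since \<open>F\<close> is Lipschitz
  near \<open>a\<close>, its limiting subdifferential is compact, so a vanishing stationarity measure is attained.
  The minorant weakens as \<open>\<gamma>\<close> decreases, which gives the equivalence of (i) and (ii), and
  prox-boundedness turns a local quadratic minorant into a global one for small \<open>\<gamma>\<close>. Hence \<open>a\<close> is
  critical iff some limiting subgradient \<open>v\<close> of \<open>F\<close> has \<open>- v\<close> as a proximal subgradient of \<open>\<phi>\<close>, and
  both parts become sum rules: in (a) the limiting one for a locally Lipschitz summand, in (b) the
  exact proximal one, available because \<open>F\<close> and \<open>- F\<close> both have proximal subgradients \<open>\<plusminus>\<nabla>F\<close>.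
\<close>

section \<open>Lower semicontinuity along filters and sequences\<close>

lemma lsc_eventually_less:
  fixes \<psi> :: "'a::t2_space \<Rightarrow> ereal"
  assumes "lower_semicontinuous \<psi>" "(z \<longlongrightarrow> a) F" "c < \<psi> a"
  shows "\<forall>\<^sub>F n in F. c < \<psi> (z n)"
proof -
  have "\<forall>\<^sub>F y in at a. c < \<psi> y"
    using assms(1,3) unfolding lower_semicontinuous_def le_Liminf_iff by blast
  \<comment> \<open>\<open>Liminf (at a)\<close> ignores the value at \<open>a\<close>; the
    hypothesis \<open>c < \<psi> a\<close> fills the puncture, so \<open>z\<close> may take the
    value \<open>a\<close>.\<close>
  then have "\<forall>\<^sub>F y in nhds a. c < \<psi> y"
    using assms(3) by (auto simp: eventually_at_filter elim: eventually_mono)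
  then show ?thesis
    using assms(2) unfolding filterlim_iff by blast
qed

lemma lsc_le_limit:
  fixes \<psi> :: "'a::t2_space \<Rightarrow> ereal"
  assumes "lower_semicontinuous \<psi>" "z \<longlonglongrightarrow> a" "b \<longlonglongrightarrow> l" "\<And>n. \<psi> (z n) \<le> b n"
  shows "\<psi> a \<le> l"
proof (rule ccontr)
  assume "\<not> \<psi> a \<le> l"
  then obtain c where c: "l < c" "c < \<psi> a"
    using dense by (meson not_le)
  have "\<forall>\<^sub>F n in sequentially. False"
    using lsc_eventually_less[OF assms(1,2) c(2)] order_tendstoD(2)[OF assms(3) c(1)]
  proof eventually_elim
    case (elim n)
    then show False using assms(4)[of n] by auto
  qed
  then show False by simp
qed

section \<open>Frechet and proximal subgradients as local minorants\<close>

text \<open>Multiplying by \<open>norm (y - a)\<close> clears the quotient, and at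
  \<open>y = a\<close> the resulting inequality is an equality, so the punctured neighbourhood
  becomes a ball.\<close>

lemma frechet_subdiff_iff:
  assumes "\<psi> a = ereal r"
  shows "v \<in> frechet_subdiff \<psi> a \<longleftrightarrow>
    (\<forall>\<epsilon>>0. \<exists>\<delta>>0. \<forall>y\<in>ball a \<delta>. ereal (r + v \<bullet> (y - a) - \<epsilon> * norm (y - a)) \<le> \<psi> y)"
proof -
  have quotient: "ereal (- \<epsilon>) \<le> (\<psi> y - \<psi> a - ereal (v \<bullet> (y - a))) / ereal (norm (y - a)) \<longleftrightarrow>
      ereal (r + v \<bullet> (y - a) - \<epsilon> * norm (y - a)) \<le> \<psi> y" if "y \<noteq> a" for y \<epsilon>
    using that by (cases "\<psi> y") (auto simp: assms field_simps)
  have "v \<in> frechet_subdiff \<psi> a \<longleftrightarrow>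
      (\<forall>\<epsilon>>0. \<forall>\<^sub>F y in at a.
         ereal (- \<epsilon>) \<le> (\<psi> y - \<psi> a - ereal (v \<bullet> (y - a))) / ereal (norm (y - a)))"
    (is "_ \<longleftrightarrow> (\<forall>\<epsilon>>0. \<forall>\<^sub>F y in at a. ereal (- \<epsilon>) \<le> ?q y)")
  proof
    assume v: "v \<in> frechet_subdiff \<psi> a"
    show "\<forall>\<epsilon>>0. \<forall>\<^sub>F y in at a. ereal (- \<epsilon>) \<le> ?q y"
    proof (intro allI impI)
      fix \<epsilon> :: real assume "\<epsilon> > 0"
      then have "ereal (- \<epsilon>) < 0" by simp
      then have "\<forall>\<^sub>F y in at a. ereal (- \<epsilon>) < ?q y"
        using v unfolding frechet_subdiff_def le_Liminf_iff by blast
      then show "\<forall>\<^sub>F y in at a. ereal (- \<epsilon>) \<le> ?q y"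
        by (auto elim: eventually_mono)
    qed
  next
    assume *: "\<forall>\<epsilon>>0. \<forall>\<^sub>F y in at a. ereal (- \<epsilon>) \<le> ?q y"
    have "\<forall>\<^sub>F y in at a. c < ?q y" if neg: "c < 0" for c
    proof -
      \<comment> \<open>\<open>c\<close> may be \<open>- \<infinity>\<close>, hence a real
        \<open>e\<close> is interposed; it also turns the weak bound into a strict one.\<close>
      obtain e where e: "c < ereal e" "ereal e < 0" using ereal_dense2[OF neg] by blast
      then have "\<forall>\<^sub>F y in at a. ereal (- (- e)) \<le> ?q y"
        by (intro *[rule_format]) simp
      then show ?thesis
        using e(1) by (auto elim!: eventually_mono)
    qed
    then show "v \<in> frechet_subdiff \<psi> a"
      by (auto simp: frechet_subdiff_def le_Liminf_iff edom_def assms)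
  qed
  also have "\<dots> \<longleftrightarrow>
    (\<forall>\<epsilon>>0. \<exists>\<delta>>0. \<forall>y\<in>ball a \<delta>. ereal (r + v \<bullet> (y - a) - \<epsilon> * norm (y - a)) \<le> \<psi> y)"
  proof (intro all_cong1 imp_cong refl)
    fix \<epsilon> :: real
    have "(\<forall>\<^sub>F y in at a. ereal (- \<epsilon>) \<le> ?q y) \<longleftrightarrow>
        (\<forall>\<^sub>F y in at a. ereal (r + v \<bullet> (y - a) - \<epsilon> * norm (y - a)) \<le> \<psi> y)"
      by (intro eventually_cong) (auto simp: quotient eventually_at_filter)
    also have "\<dots> \<longleftrightarrow> (\<forall>\<^sub>F y in nhds a. ereal (r + v \<bullet> (y - a) - \<epsilon> * norm (y - a)) \<le> \<psi> y)"
      unfolding eventually_at_filter by (intro eventually_cong always_eventually) (auto simp: assms)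
    finally show "(\<forall>\<^sub>F y in at a. ereal (- \<epsilon>) \<le> ?q y) \<longleftrightarrow>
        (\<exists>\<delta>>0. \<forall>y\<in>ball a \<delta>. ereal (r + v \<bullet> (y - a) - \<epsilon> * norm (y - a)) \<le> \<psi> y)"
      by (simp add: eventually_nhds_metric Ball_def dist_commute)
  qed
  finally show ?thesis .
qed

lemma proximal_subdiff_iff:
  assumes "\<psi> a = ereal r"
  shows "v \<in> proximal_subdiff \<psi> a \<longleftrightarrow>
    (\<exists>c. \<exists>\<delta>>0. \<forall>y\<in>ball a \<delta>. ereal (r + v \<bullet> (y - a) - c * (norm (y - a))\<^sup>2) \<le> \<psi> y)"
proof
  assume "v \<in> proximal_subdiff \<psi> a"
  then obtain \<gamma> \<delta> where "\<delta> > 0"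
    "\<And>y. y \<in> ball a \<delta> \<Longrightarrow> \<psi> a + ereal (v \<bullet> (y - a) - 1 / (2 * \<gamma>) * (norm (y - a))\<^sup>2) \<le> \<psi> y"
    unfolding proximal_subdiff_def by blast
  then show "\<exists>c. \<exists>\<delta>>0. \<forall>y\<in>ball a \<delta>. ereal (r + v \<bullet> (y - a) - c * (norm (y - a))\<^sup>2) \<le> \<psi> y"
    by (intro exI[of _ "1 / (2 * \<gamma>)"] exI[of _ \<delta>]) (simp add: assms add_diff_eq)
next
  assume "\<exists>c. \<exists>\<delta>>0. \<forall>y\<in>ball a \<delta>. ereal (r + v \<bullet> (y - a) - c * (norm (y - a))\<^sup>2) \<le> \<psi> y"
  then obtain c \<delta> where "\<delta> > 0"
    and c: "\<And>y. y \<in> ball a \<delta> \<Longrightarrow> ereal (r + v \<bullet> (y - a) - c * (norm (y - a))\<^sup>2) \<le> \<psi> y"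
    by blast
  \<comment> \<open>\<open>c\<close> may have any sign; \<open>\<bar>c\<bar> + 1\<close> dominates
    it, is positive, and so has the form \<open>1 / (2 * \<gamma>)\<close> with
    \<open>\<gamma> > 0\<close>.\<close>
  define \<gamma> where "\<gamma> = 1 / (2 * (\<bar>c\<bar> + 1))"
  have "\<gamma> > 0" and \<gamma>: "1 / (2 * \<gamma>) = \<bar>c\<bar> + 1" by (auto simp: \<gamma>_def)
  have "ereal (r + (v \<bullet> (y - a) - 1 / (2 * \<gamma>) * (norm (y - a))\<^sup>2)) \<le> \<psi> y" if "y \<in> ball a \<delta>" for y
  proof (rule order_trans[OF _ c[OF that]])
    have "c * (norm (y - a))\<^sup>2 \<le> (\<bar>c\<bar> + 1) * (norm (y - a))\<^sup>2"
      by (intro mult_right_mono) auto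
    then show "ereal (r + (v \<bullet> (y - a) - 1 / (2 * \<gamma>) * (norm (y - a))\<^sup>2))
        \<le> ereal (r + v \<bullet> (y - a) - c * (norm (y - a))\<^sup>2)"
      unfolding \<gamma> by simp
  qed
  then have "\<exists>\<gamma>>0. \<exists>\<delta>>0. \<forall>y\<in>ball a \<delta>.
      \<psi> a + ereal (v \<bullet> (y - a) - 1 / (2 * \<gamma>) * (norm (y - a))\<^sup>2) \<le> \<psi> y"
    using \<open>\<gamma> > 0\<close> \<open>\<delta> > 0\<close> unfolding assms plus_ereal.simps by blast
  then show "v \<in> proximal_subdiff \<psi> a"
    by (simp add: proximal_subdiff_def edom_def assms)
qed

lemma proximal_subdiff_subset_frechet:
  assumes "\<psi> a = ereal r"
  shows "proximal_subdiff \<psi> a \<subseteq> frechet_subdiff \<psi> a"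
proof
  fix v assume "v \<in> proximal_subdiff \<psi> a"
  then obtain c \<delta> where "\<delta> > 0"
    and c: "\<And>y. y \<in> ball a \<delta> \<Longrightarrow> ereal (r + v \<bullet> (y - a) - c * (norm (y - a))\<^sup>2) \<le> \<psi> y"
    unfolding proximal_subdiff_iff[of \<psi>, OF assms] by blast
  show "v \<in> frechet_subdiff \<psi> a"
    unfolding frechet_subdiff_iff[of \<psi>, OF assms]
  proof (intro allI impI)
    fix \<epsilon> :: real assume "\<epsilon> > 0"
    \<comment> \<open>Within distance \<open>\<epsilon> / (\<bar>c\<bar> + 1)\<close> the quadratic
      error is at most \<open>\<epsilon> * norm (y - a)\<close>.\<close>
    define d where "d = min \<delta> (\<epsilon> / (\<bar>c\<bar> + 1))"
    have "ereal (r + v \<bullet> (y - a) - \<epsilon> * norm (y - a)) \<le> \<psi> y" if "y \<in> ball a d" for y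
    proof -
      have y: "y \<in> ball a \<delta>" "norm (y - a) \<le> \<epsilon> / (\<bar>c\<bar> + 1)"
        using that by (auto simp: d_def dist_norm norm_minus_commute)
      have "c * norm (y - a) \<le> (\<bar>c\<bar> + 1) * norm (y - a)"
        by (intro mult_right_mono) auto
      also have "\<dots> \<le> \<epsilon>"
        using y(2) by (simp add: field_simps add_pos_nonneg)
      finally have "c * norm (y - a) * norm (y - a) \<le> \<epsilon> * norm (y - a)"
        by (intro mult_right_mono) auto
      then show ?thesis
        by (intro order_trans[OF _ c[OF y(1)]]) (simp add: power2_eq_square mult.assoc)
    qed
    moreover have "d > 0" using \<open>\<delta> > 0\<close> \<open>\<epsilon> > 0\<close> by (simp add: d_def add_nonneg_pos)
    ultimately show "\<exists>\<delta>>0. \<forall>y\<in>ball a \<delta>. ereal (r + v \<bullet> (y - a) - \<epsilon> * norm (y - a)) \<le> \<psi> y"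
      by blast
  qed
qed

lemma frechet_subdiff_subset_limiting: "frechet_subdiff \<psi> a \<subseteq> limiting_subdiff \<psi> a"
proof
  fix v assume "v \<in> frechet_subdiff \<psi> a"
  moreover from this have "a \<in> edom \<psi>" by (simp add: frechet_subdiff_def)
  ultimately show "v \<in> limiting_subdiff \<psi> a"
    unfolding limiting_subdiff_def
    by (intro CollectI conjI exI[of _ "\<lambda>_. a"] exI[of _ "\<lambda>_. v"]) simp_all
qed

section \<open>Calculus of proximal and Frechet subgradients\<close>

lemma proximal_subdiffI:
  assumes "\<psi> a = ereal r" "open V" "a \<in> V"
    and "\<And>y. y \<in> V \<Longrightarrow> ereal (r + v \<bullet> (y - a) - c * (norm (y - a))\<^sup>2) \<le> \<psi> y"
  shows "v \<in> proximal_subdiff \<psi> a"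
proof -
  obtain \<delta> where "\<delta> > 0" "ball a \<delta> \<subseteq> V" using assms(2,3) openE by blast
  then show ?thesis
    unfolding proximal_subdiff_iff[of \<psi>, OF assms(1)] using assms(4)
    by (intro exI[of _ c] exI[of _ \<delta>]) blast
qed

text \<open>Both functions agree at \<open>a\<close>, so a local minorant of the smaller one also
  supports the larger. Only values near \<open>a\<close> count, which lets cancellations that are
  valid merely near \<open>a\<close> be exploited.\<close>

lemma proximal_subdiff_mono:
  assumes "\<psi> a = ereal r" "\<theta> a = ereal r" "open V" "a \<in> V"
    and "\<And>y. y \<in> V \<Longrightarrow> \<psi> y \<le> \<theta> y" "v \<in> proximal_subdiff \<psi> a"
  shows "v \<in> proximal_subdiff \<theta> a"
proof -
  obtain c \<delta> where "\<delta> > 0"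
    and c: "\<And>y. y \<in> ball a \<delta> \<Longrightarrow> ereal (r + v \<bullet> (y - a) - c * (norm (y - a))\<^sup>2) \<le> \<psi> y"
    using assms(6) unfolding proximal_subdiff_iff[of \<psi>, OF assms(1)] by blast
  show ?thesis
    by (rule proximal_subdiffI[of _ _ _ "V \<inter> ball a \<delta>"])
      (use assms \<open>\<delta> > 0\<close> c in \<open>auto intro: order_trans\<close>)
qed

lemma proximal_subdiff_add:
  assumes "\<psi> a = ereal r" "\<theta> a = ereal s"
    and "v \<in> proximal_subdiff \<psi> a" "w \<in> proximal_subdiff \<theta> a"
  shows "v + w \<in> proximal_subdiff (\<lambda>y. \<psi> y + \<theta> y) a"
proof -
  obtain c d where d: "d > 0"
    "\<And>y. y \<in> ball a d \<Longrightarrow> ereal (r + v \<bullet> (y - a) - c * (norm (y - a))\<^sup>2) \<le> \<psi> y"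
    using assms(3) unfolding proximal_subdiff_iff[of \<psi>, OF assms(1)] by blast
  obtain c' e where e: "e > 0"
    "\<And>y. y \<in> ball a e \<Longrightarrow> ereal (s + w \<bullet> (y - a) - c' * (norm (y - a))\<^sup>2) \<le> \<theta> y"
    using assms(4) unfolding proximal_subdiff_iff[of \<theta>, OF assms(2)] by blast
  show ?thesis
  proof (rule proximal_subdiffI[where r = "r + s" and V = "ball a (min d e)" and c = "c + c'"])
    fix y assume "y \<in> ball a (min d e)"
    then show "ereal (r + s + (v + w) \<bullet> (y - a) - (c + c') * (norm (y - a))\<^sup>2) \<le> \<psi> y + \<theta> y"
      using add_mono[OF d(2)[of y] e(2)[of y]] by (simp add: algebra_simps)
  qed (use assms d(1) e(1) in simp_all)
qed

lemma frechet_subdiff_add: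
  assumes "\<psi> a = ereal r" "\<theta> a = ereal s"
    and "v \<in> frechet_subdiff \<psi> a" "w \<in> frechet_subdiff \<theta> a"
  shows "v + w \<in> frechet_subdiff (\<lambda>y. \<psi> y + \<theta> y) a"
proof -
  have "\<psi> a + \<theta> a = ereal (r + s)" using assms by simp
  show ?thesis
    unfolding frechet_subdiff_iff[of "\<lambda>y. \<psi> y + \<theta> y", OF \<open>\<psi> a + \<theta> a = ereal (r + s)\<close>]
  proof (intro allI impI)
    fix \<epsilon> :: real assume "\<epsilon> > 0"
    then have "\<epsilon> / 2 > 0" by simp
    obtain d where d: "d > 0"
      "\<And>y. y \<in> ball a d \<Longrightarrow> ereal (r + v \<bullet> (y - a) - \<epsilon> / 2 * norm (y - a)) \<le> \<psi> y"
      using assms(3) \<open>\<epsilon> / 2 > 0\<close> unfolding frechet_subdiff_iff[of \<psi>, OF assms(1)] by meson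
    obtain e where e: "e > 0"
      "\<And>y. y \<in> ball a e \<Longrightarrow> ereal (s + w \<bullet> (y - a) - \<epsilon> / 2 * norm (y - a)) \<le> \<theta> y"
      using assms(4) \<open>\<epsilon> / 2 > 0\<close> unfolding frechet_subdiff_iff[of \<theta>, OF assms(2)] by meson
    have "ereal (r + s + (v + w) \<bullet> (y - a) - \<epsilon> * norm (y - a)) \<le> \<psi> y + \<theta> y"
      if "y \<in> ball a (min d e)" for y
      using add_mono[OF d(2)[of y] e(2)[of y]] that by (simp add: algebra_simps)
    then show "\<exists>\<delta>>0. \<forall>y\<in>ball a \<delta>.
        ereal (r + s + (v + w) \<bullet> (y - a) - \<epsilon> * norm (y - a)) \<le> \<psi> y + \<theta> y"
      using d(1) e(1) by (intro exI[of _ "min d e"]) simp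
  qed
qed

section \<open>Limiting subdifferentials: closedness and Lipschitz bounds\<close>

text \<open>Limiting subgradients form a slice of the closure of the graph of the Frechet ones, with
  the function value kept as a coordinate. Closedness then follows from a continuous preimage
  instead of a diagonal sequence.\<close>

lemma limiting_subdiff_eq_closure:
  "limiting_subdiff \<psi> a =
     {v. a \<in> edom \<psi> \<and> (a, \<psi> a, v) \<in> closure {(y, \<psi> y, w) |y w. w \<in> frechet_subdiff \<psi> y}}"
  (is "_ = {v. _ \<and> _ \<in> closure ?G}")
proof -
  have "(\<exists>x w. x \<longlonglongrightarrow> a \<and> (\<lambda>n. \<psi> (x n)) \<longlonglongrightarrow> \<psi> a \<and>
          (\<forall>n. w n \<in> frechet_subdiff \<psi> (x n)) \<and> w \<longlonglongrightarrow> v) \<longleftrightarrow> (a, \<psi> a, v) \<in> closure ?G" for v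
  proof
    assume "\<exists>x w. x \<longlonglongrightarrow> a \<and> (\<lambda>n. \<psi> (x n)) \<longlonglongrightarrow> \<psi> a \<and>
          (\<forall>n. w n \<in> frechet_subdiff \<psi> (x n)) \<and> w \<longlonglongrightarrow> v"
    then obtain x w where xw: "x \<longlonglongrightarrow> a" "(\<lambda>n. \<psi> (x n)) \<longlonglongrightarrow> \<psi> a" "w \<longlonglongrightarrow> v"
      "\<And>n. w n \<in> frechet_subdiff \<psi> (x n)" by blast
    then have "(\<lambda>n. (x n, \<psi> (x n), w n)) \<longlonglongrightarrow> (a, \<psi> a, v)"
      by (intro tendsto_Pair)
    then show "(a, \<psi> a, v) \<in> closure ?G"
      unfolding closure_sequential using xw(4)
      by (intro exI[of _ "\<lambda>n. (x n, \<psi> (x n), w n)"]) blast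
  next
    assume "(a, \<psi> a, v) \<in> closure ?G"
    then obtain g where g: "\<And>n. g n \<in> ?G" "g \<longlonglongrightarrow> (a, \<psi> a, v)"
      unfolding closure_sequential by blast
    have "fst (snd (g n)) = \<psi> (fst (g n))" "snd (snd (g n)) \<in> frechet_subdiff \<psi> (fst (g n))" for n
      using g(1)[of n] by auto
    then show "\<exists>x w. x \<longlonglongrightarrow> a \<and> (\<lambda>n. \<psi> (x n)) \<longlonglongrightarrow> \<psi> a \<and>
          (\<forall>n. w n \<in> frechet_subdiff \<psi> (x n)) \<and> w \<longlonglongrightarrow> v"
      using tendsto_fst[OF g(2)] tendsto_fst[OF tendsto_snd[OF g(2)]]
        tendsto_snd[OF tendsto_snd[OF g(2)]]
      by (intro exI[of _ "\<lambda>n. fst (g n)"] exI[of _ "\<lambda>n. snd (snd (g n))"]) simp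
  qed
  then show ?thesis unfolding limiting_subdiff_def by simp
qed

lemma closed_limiting_subdiff: "closed (limiting_subdiff \<psi> a)"
proof (cases "a \<in> edom \<psi>")
  case True
  have "continuous_on UNIV (\<lambda>v. (a, \<psi> a, v))"
    by (intro continuous_intros)
  then have "closed ((\<lambda>v. (a, \<psi> a, v)) -` closure {(y, \<psi> y, w) |y w. w \<in> frechet_subdiff \<psi> y})"
    using closed_vimage closed_closure by blast
  then show ?thesis
    unfolding limiting_subdiff_eq_closure using True by (simp add: vimage_def)
qed (simp add: limiting_subdiff_def)

text \<open>A small step from \<open>a\<close> in the direction \<open>v\<close> raises
  \<open>f\<close> at a rate of at least \<open>norm v - \<epsilon>\<close> but at most
  \<open>L\<close>.\<close>

lemma norm_frechet_subdiff_le_lipschitz: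
  assumes "open U" "a \<in> U" "L-lipschitz_on U f" "\<And>y. y \<in> U \<Longrightarrow> \<psi> y = ereal (f y)"
    and "v \<in> frechet_subdiff \<psi> a"
  shows "norm v \<le> L"
proof (rule field_le_epsilon)
  fix \<epsilon> :: real assume "\<epsilon> > 0"
  obtain r where r: "r > 0" "ball a r \<subseteq> U" using assms openE by blast
  obtain d where d: "d > 0"
    "\<And>y. y \<in> ball a d \<Longrightarrow> ereal (f a + v \<bullet> (y - a) - \<epsilon> * norm (y - a)) \<le> \<psi> y"
    using assms(5) \<open>\<epsilon> > 0\<close> unfolding frechet_subdiff_iff[of \<psi>, OF assms(4)[OF assms(2)]] by meson
  show "norm v \<le> L + \<epsilon>"
  proof (cases "v = 0")
    case True
    then show ?thesis using lipschitz_on_nonneg[OF assms(3)] \<open>\<epsilon> > 0\<close> by simp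
  next
    case False
    \<comment> \<open>Puts \<open>y\<close> at distance \<open>min r d / 2\<close> from
      \<open>a\<close>, inside both balls.\<close>
    define t where "t = min r d / (2 * norm v)"
    have t: "t > 0" using False r d by (simp add: t_def)
    define y where "y = a + t *\<^sub>R v"
    have ny: "norm (y - a) = t * norm v" using t by (simp add: y_def)
    also have "t * norm v = min r d / 2" using False by (simp add: t_def)
    also have "\<dots> < min r d" using r d by (simp add: min_def)
    finally have "y \<in> ball a r" "y \<in> ball a d" by (auto simp: dist_norm norm_minus_commute)
    then have "y \<in> U" using r by blast
    then have "f a + v \<bullet> (y - a) - \<epsilon> * norm (y - a) \<le> f y"
      using d(2)[OF \<open>y \<in> ball a d\<close>] assms(4) by simp
    also have "f y \<le> f a + L * norm (y - a)"
      using lipschitz_onD[OF assms(3) \<open>y \<in> U\<close> assms(2)] by (simp add: dist_norm)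
    finally have "v \<bullet> (y - a) \<le> (L + \<epsilon>) * norm (y - a)" by (simp add: algebra_simps)
    then have "(t * norm v) * norm v \<le> (t * norm v) * (L + \<epsilon>)"
      unfolding ny by (simp add: y_def power2_norm_eq_inner[symmetric] power2_eq_square mult.commute mult.left_commute)
    then show ?thesis using t False by simp
  qed
qed

lemma norm_limiting_subdiff_le_lipschitz:
  assumes "open U" "a \<in> U" "L-lipschitz_on U f" "\<And>y. y \<in> U \<Longrightarrow> \<psi> y = ereal (f y)"
    and "v \<in> limiting_subdiff \<psi> a"
  shows "norm v \<le> L"
proof -
  obtain x w where xw: "x \<longlonglongrightarrow> a" "\<And>n. w n \<in> frechet_subdiff \<psi> (x n)" "w \<longlonglongrightarrow> v"
    using assms(5) unfolding limiting_subdiff_def by blast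
  \<comment> \<open>The bound on \<open>w n\<close> is available only once \<open>x n\<close> has
    entered \<open>U\<close>.\<close>
  have "\<forall>\<^sub>F n in sequentially. norm (w n) \<le> L"
    using topological_tendstoD[OF xw(1) assms(1,2)]
    by eventually_elim (rule norm_frechet_subdiff_le_lipschitz[OF assms(1) _ assms(3,4) xw(2)])
  then show ?thesis
    using tendsto_upperbound[OF tendsto_norm[OF xw(3)]] by simp
qed

section \<open>Proximal points and the stationarity measure\<close>

text \<open>Recentring a square at \<open>p\<close>: the mixed term supplies the subgradient and the
  last term its quadratic error.\<close>

lemma power2_norm_diff_expand:
  fixes c p u :: "'a::real_inner"
  shows "(norm (u - c))\<^sup>2 = (norm (p - c))\<^sup>2 + 2 * ((p - c) \<bullet> (u - p)) + (norm (u - p))\<^sup>2"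
  by (simp add: power2_norm_eq_inner inner_diff_left inner_diff_right inner_commute algebra_simps)

lemma mem_prox_iff_minorant:
  assumes "\<phi> a = ereal s" "\<gamma> > 0"
  shows "a \<in> prox \<gamma> \<phi> (a - \<gamma> *\<^sub>R v) \<longleftrightarrow>
    (\<forall>y. ereal (s - v \<bullet> (y - a) - 1 / (2 * \<gamma>) * (norm (y - a))\<^sup>2) \<le> \<phi> y)"
proof -
  have "\<phi> a + ereal (1 / (2 * \<gamma>) * (norm (a - (a - \<gamma> *\<^sub>R v)))\<^sup>2)
      \<le> \<phi> y + ereal (1 / (2 * \<gamma>) * (norm (y - (a - \<gamma> *\<^sub>R v)))\<^sup>2) \<longleftrightarrow>
    ereal (s - v \<bullet> (y - a) - 1 / (2 * \<gamma>) * (norm (y - a))\<^sup>2) \<le> \<phi> y" for y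
  proof -
    have "1 / (2 * \<gamma>) * (norm (y - (a - \<gamma> *\<^sub>R v)))\<^sup>2 =
        1 / (2 * \<gamma>) * (norm (a - (a - \<gamma> *\<^sub>R v)))\<^sup>2 + v \<bullet> (y - a) + 1 / (2 * \<gamma>) * (norm (y - a))\<^sup>2"
      unfolding power2_norm_diff_expand[of y "a - \<gamma> *\<^sub>R v" a] using \<open>\<gamma> > 0\<close>
      by (simp add: field_simps)
    then show ?thesis
      by (cases "\<phi> y") (auto simp: assms(1))
  qed
  then show ?thesis
    by (simp add: prox_def is_arg_min_def not_less)
qed

text \<open>An infimum of zero yields \<open>p n\<close> tending to \<open>a\<close> with
  multipliers \<open>v n\<close> in a compact set. Along a subsequence on which the multipliers tend
  to \<open>w\<close>, lower semicontinuity carries the minimality of \<open>p n\<close> over to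
  \<open>a\<close>.\<close>

lemma stationarity_measure_eq_0_iff:
  assumes "lower_semicontinuous \<phi>" "\<And>y. \<phi> y \<noteq> -\<infinity>" "bounded (limiting_subdiff F a)" "\<gamma> > 0"
  shows "stationarity_measure \<gamma> F \<phi> a = 0 \<longleftrightarrow>
    (\<exists>v\<in>limiting_subdiff F a. a \<in> prox \<gamma> \<phi> (a - \<gamma> *\<^sub>R v))"
proof
  assume zero: "stationarity_measure \<gamma> F \<phi> a = 0"
  have "\<exists>p v. p \<in> prox \<gamma> \<phi> (a - \<gamma> *\<^sub>R v) \<and> v \<in> limiting_subdiff F a \<and>
      norm ((1 / \<gamma>) *\<^sub>R (a - p)) < inverse (real (Suc n))" for n
  proof -
    have "stationarity_measure \<gamma> F \<phi> a < ereal (inverse (real (Suc n)))"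
      unfolding zero by simp
    then show ?thesis
      unfolding stationarity_measure_def Inf_less_iff
      by (clarsimp simp del: norm_scaleR of_nat_Suc) blast
  qed
  then obtain p v where p: "\<And>n. p n \<in> prox \<gamma> \<phi> (a - \<gamma> *\<^sub>R v n)"
    and v: "\<And>n. v n \<in> limiting_subdiff F a"
    and lim: "\<And>n. norm ((1 / \<gamma>) *\<^sub>R (a - p n)) < inverse (real (Suc n))"
    by metis
  have "(\<lambda>n. (1 / \<gamma>) *\<^sub>R (a - p n)) \<longlonglongrightarrow> 0"
    by (rule LIMSEQ_norm_0) (use lim in \<open>simp add: inverse_eq_divide\<close>)
  then have "(\<lambda>n. a - \<gamma> *\<^sub>R ((1 / \<gamma>) *\<^sub>R (a - p n))) \<longlonglongrightarrow> a - \<gamma> *\<^sub>R 0"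
    by (intro tendsto_intros)
  then have p_lim: "p \<longlonglongrightarrow> a" using \<open>\<gamma> > 0\<close> by simp
  have "compact (limiting_subdiff F a)"
    using assms(3) closed_limiting_subdiff by (simp add: compact_eq_bounded_closed)
  then obtain w \<rho> where w: "w \<in> limiting_subdiff F a" "strict_mono \<rho>" "(v \<circ> \<rho>) \<longlonglongrightarrow> w"
    using v unfolding compact_def by metis
  have p_lim': "(\<lambda>n. p (\<rho> n)) \<longlonglongrightarrow> a"
    using LIMSEQ_subseq_LIMSEQ[OF p_lim w(2)] by (simp add: comp_def)
  have w_lim: "(\<lambda>n. v (\<rho> n)) \<longlonglongrightarrow> w" using w(3) by (simp add: comp_def)
  let ?q = "\<lambda>y v. 1 / (2 * \<gamma>) * (norm (y - (a - \<gamma> *\<^sub>R v)))\<^sup>2"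
  have "\<phi> a + ereal (?q a w) \<le> \<phi> y + ereal (?q y w)" for y
  proof (cases "\<phi> y")
    case (real t)
    \<comment> \<open>Minimality against a fixed competitor \<open>y\<close>, solved for
      \<open>\<phi>\<close> at the proximal point so that the right-hand side converges.\<close>
    have "\<phi> (p (\<rho> n)) \<le> ereal (t + ?q y (v (\<rho> n)) - ?q (p (\<rho> n)) (v (\<rho> n)))" for n
    proof -
      have "\<phi> (p (\<rho> n)) + ereal (?q (p (\<rho> n)) (v (\<rho> n))) \<le> \<phi> y + ereal (?q y (v (\<rho> n)))"
        using p[of "\<rho> n"] by (auto simp: prox_def is_arg_min_def not_less)
      then show ?thesis using real by (cases "\<phi> (p (\<rho> n))") auto
    qed
    moreover have "(\<lambda>n. ereal (t + ?q y (v (\<rho> n)) - ?q (p (\<rho> n)) (v (\<rho> n))))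
        \<longlonglongrightarrow> ereal (t + ?q y w - ?q a w)"
      by (intro tendsto_intros w_lim p_lim')
    ultimately have "\<phi> a \<le> ereal (t + ?q y w - ?q a w)"
      using lsc_le_limit[OF assms(1) p_lim'] by blast
    then show ?thesis using real by (cases "\<phi> a") auto
  qed (use assms(2) in auto)
  then have "a \<in> prox \<gamma> \<phi> (a - \<gamma> *\<^sub>R w)"
    by (simp add: prox_def is_arg_min_def not_less)
  then show "\<exists>v\<in>limiting_subdiff F a. a \<in> prox \<gamma> \<phi> (a - \<gamma> *\<^sub>R v)"
    using w(1) by blast
next
  assume "\<exists>v\<in>limiting_subdiff F a. a \<in> prox \<gamma> \<phi> (a - \<gamma> *\<^sub>R v)"
  then obtain v where "v \<in> limiting_subdiff F a" "a \<in> prox \<gamma> \<phi> (a - \<gamma> *\<^sub>R v)" by blast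
  then have "stationarity_measure \<gamma> F \<phi> a \<le> ereal (norm ((1 / \<gamma>) *\<^sub>R (a - a)))"
    unfolding stationarity_measure_def by (intro Inf_lower) blast
  moreover have "0 \<le> stationarity_measure \<gamma> F \<phi> a"
    unfolding stationarity_measure_def by (intro Inf_greatest) auto
  ultimately show "stationarity_measure \<gamma> F \<phi> a = 0"
    by (simp add: zero_ereal_def[symmetric] order_antisym)
qed

text \<open>In a ball around \<open>a\<close> the proximal inequality serves. Outside it,
  prox-boundedness bounds \<open>\<phi>\<close> below by a constant minus a multiple of
  \<open>(norm y)\<^sup>2\<close>; there \<open>norm (y - a)\<close> is at least
  \<open>\<delta>\<close>, so constant and linear terms are absorbed by a multiple of the squared
  distance.\<close>

lemma prox_bounded_proximal_minorant:
  assumes "prox_bounded \<phi> \<gamma>\<^sub>0" "\<phi> a = ereal s" "w \<in> proximal_subdiff \<phi> a"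
  shows "\<exists>\<gamma>>0. ereal \<gamma> < \<gamma>\<^sub>0 \<and>
    (\<forall>y. ereal (s + w \<bullet> (y - a) - 1 / (2 * \<gamma>) * (norm (y - a))\<^sup>2) \<le> \<phi> y)"
proof -
  have "0 < \<gamma>\<^sub>0" using assms(1) by (simp add: prox_bounded_def)
  then obtain \<beta> where \<beta>: "\<beta> > 0" "ereal \<beta> < \<gamma>\<^sub>0"
    using ereal_dense2[of 0 "\<gamma>\<^sub>0"] by auto
  then obtain m where m: "\<And>y. ereal m \<le> \<phi> y + ereal (1 / (2 * \<beta>) * (norm y)\<^sup>2)"
    using assms(1) unfolding prox_bounded_def by blast
  obtain c \<delta> where \<delta>: "\<delta> > 0"
    and c: "\<And>y. y \<in> ball a \<delta> \<Longrightarrow> ereal (s + w \<bullet> (y - a) - c * (norm (y - a))\<^sup>2) \<le> \<phi> y"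
    using assms(3) unfolding proximal_subdiff_iff[of \<phi>, OF assms(2)] by blast
  define M where "M = \<bar>s - m + (norm a)\<^sup>2 / \<beta>\<bar>"
  \<comment> \<open>\<open>\<bar>c\<bar>\<close> handles the ball; the other three summands absorb,
    outside it, the constant, the linear term and the quadratic decay allowed by
    prox-boundedness.\<close>
  define K where "K = \<bar>c\<bar> + M / \<delta>\<^sup>2 + norm w / \<delta> + 1 / \<beta>"
  have parts: "0 \<le> M / \<delta>\<^sup>2" "0 \<le> norm w / \<delta>" "0 < 1 / \<beta>"
    using \<delta> \<beta> by (auto simp: M_def)
  then have "K > 0" "c \<le> K" unfolding K_def by linarith+
  \<comment> \<open>\<open>\<beta>\<close> keeps \<open>\<gamma>\<close> below the threshold; the
    other bound gives \<open>K \<le> 1 / (2 * \<gamma>)\<close>.\<close>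
  define \<gamma> where "\<gamma> = min \<beta> (1 / (2 * K))"
  have \<gamma>: "\<gamma> > 0" "ereal \<gamma> < \<gamma>\<^sub>0"
    using \<beta> \<open>K > 0\<close> by (auto simp: \<gamma>_def min_def intro: order_le_less_trans[OF _ \<beta>(2)])
  have "\<gamma> \<le> 1 / (2 * K)" by (simp add: \<gamma>_def)
  then have K: "K \<le> 1 / (2 * \<gamma>)" using \<open>K > 0\<close> \<gamma>(1) by (simp add: field_simps)
  have "ereal (s + w \<bullet> (y - a) - K * (norm (y - a))\<^sup>2) \<le> \<phi> y" for y
  proof (cases "y \<in> ball a \<delta>")
    case True
    have "c * (norm (y - a))\<^sup>2 \<le> K * (norm (y - a))\<^sup>2"
      using \<open>c \<le> K\<close> by (intro mult_right_mono) auto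
    then show ?thesis by (intro order_trans[OF _ c[OF True]]) simp
  next
    case False
    define t where "t = norm (y - a)"
    have t: "\<delta> \<le> t" using False by (simp add: t_def dist_norm norm_minus_commute)
    have "(norm y)\<^sup>2 \<le> (norm a + t)\<^sup>2"
      using norm_triangle_ineq[of a "y - a"] by (intro power_mono) (auto simp: t_def)
    also have "\<dots> \<le> 2 * (norm a)\<^sup>2 + 2 * t\<^sup>2"
      using sum_squares_bound[of "norm a" t] by (simp add: power2_sum)
    finally have "1 / (2 * \<beta>) * (norm y)\<^sup>2 \<le> 1 / (2 * \<beta>) * (2 * (norm a)\<^sup>2 + 2 * t\<^sup>2)"
      using \<beta> by (intro mult_left_mono) auto
    also have "\<dots> = (norm a)\<^sup>2 / \<beta> + 1 / \<beta> * t\<^sup>2"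
      using \<beta> by (simp add: field_simps)
    finally have y: "1 / (2 * \<beta>) * (norm y)\<^sup>2 \<le> (norm a)\<^sup>2 / \<beta> + 1 / \<beta> * t\<^sup>2" .
    have "\<delta>\<^sup>2 \<le> t\<^sup>2" using t \<delta> by (intro power_mono) auto
    then have "M * \<delta>\<^sup>2 \<le> M * t\<^sup>2" by (intro mult_left_mono) (auto simp: M_def)
    then have M: "M \<le> M / \<delta>\<^sup>2 * t\<^sup>2" using \<delta> by (simp add: field_simps)
    have "w \<bullet> (y - a) \<le> norm w * t" unfolding t_def by (rule norm_cauchy_schwarz)
    moreover have "norm w * t * \<delta> \<le> norm w * t * t"
      using t \<delta> by (intro mult_left_mono) auto
    then have "norm w * t \<le> norm w / \<delta> * t\<^sup>2"
      using \<delta> by (simp add: field_simps power2_eq_square)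
    moreover have "0 \<le> \<bar>c\<bar> * t\<^sup>2" by simp
    moreover have "s - m + (norm a)\<^sup>2 / \<beta> \<le> M" by (simp add: M_def)
    moreover have "K * t\<^sup>2 = \<bar>c\<bar> * t\<^sup>2 + M / \<delta>\<^sup>2 * t\<^sup>2 + norm w / \<delta> * t\<^sup>2 + 1 / \<beta> * t\<^sup>2"
      unfolding K_def by (simp add: ring_distribs)
    ultimately have "s + w \<bullet> (y - a) - K * t\<^sup>2 \<le> m - 1 / (2 * \<beta>) * (norm y)\<^sup>2"
      using M y by linarith
    moreover have "ereal (m - 1 / (2 * \<beta>) * (norm y)\<^sup>2) \<le> \<phi> y"
      using m[of y] by (cases "\<phi> y") auto
    ultimately show ?thesis
      unfolding t_def by (meson ereal_less_eq(3) order_trans)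
  qed
  moreover have "s + w \<bullet> (y - a) - 1 / (2 * \<gamma>) * (norm (y - a))\<^sup>2
      \<le> s + w \<bullet> (y - a) - K * (norm (y - a))\<^sup>2" for y
    using mult_right_mono[OF K, of "(norm (y - a))\<^sup>2"] by simp
  ultimately have "\<forall>y. ereal (s + w \<bullet> (y - a) - 1 / (2 * \<gamma>) * (norm (y - a))\<^sup>2) \<le> \<phi> y"
    by (meson ereal_less_eq(3) order_trans)
  then show ?thesis using \<gamma> by blast
qed

lemma critical_point_iff:
  assumes "lower_semicontinuous \<phi>" "\<And>y. \<phi> y \<noteq> -\<infinity>" "bounded (limiting_subdiff F a)"
    and "prox_bounded \<phi> \<gamma>\<^sub>0" "a \<in> edom \<phi>"
  shows "critical_point \<gamma>\<^sub>0 F \<phi> a \<longleftrightarrow> (\<exists>v\<in>limiting_subdiff F a. - v \<in> proximal_subdiff \<phi> a)"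
proof -
  obtain s where s: "\<phi> a = ereal s"
    using assms(2)[of a] assms(5) by (cases "\<phi> a") (auto simp: edom_def)
  note zero_iff = stationarity_measure_eq_0_iff[OF assms(1-3)] mem_prox_iff_minorant[of \<phi>, OF s]
  show ?thesis
  proof
    assume "critical_point \<gamma>\<^sub>0 F \<phi> a"
    then obtain \<gamma> v where "\<gamma> > 0" "v \<in> limiting_subdiff F a"
      and v: "\<And>y. ereal (s - v \<bullet> (y - a) - 1 / (2 * \<gamma>) * (norm (y - a))\<^sup>2) \<le> \<phi> y"
      unfolding critical_point_def using zero_iff by blast
    have "- v \<in> proximal_subdiff \<phi> a"
      by (rule proximal_subdiffI[of \<phi>, OF s open_UNIV, of _ "1 / (2 * \<gamma>)"]) (use v in simp_all)
    then show "\<exists>v\<in>limiting_subdiff F a. - v \<in> proximal_subdiff \<phi> a"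
      using \<open>v \<in> limiting_subdiff F a\<close> by blast
  next
    assume "\<exists>v\<in>limiting_subdiff F a. - v \<in> proximal_subdiff \<phi> a"
    then obtain v where v: "v \<in> limiting_subdiff F a" "- v \<in> proximal_subdiff \<phi> a" by blast
    obtain \<gamma> where \<gamma>: "\<gamma> > 0" "ereal \<gamma> < \<gamma>\<^sub>0"
      "\<forall>y. ereal (s - v \<bullet> (y - a) - 1 / (2 * \<gamma>) * (norm (y - a))\<^sup>2) \<le> \<phi> y"
      using prox_bounded_proximal_minorant[OF assms(4) s v(2)] by auto
    then have "stationarity_measure \<gamma> F \<phi> a = 0"
      using zero_iff v(1) by blast
    then show "critical_point \<gamma>\<^sub>0 F \<phi> a"
      unfolding critical_point_def using \<gamma> by blast
  qed
qed

text \<open>The same multiplier \<open>v\<close> serves both step sizes.\<close>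

lemma stationarity_measure_eq_0_antimono:
  assumes "lower_semicontinuous \<phi>" "\<And>y. \<phi> y \<noteq> -\<infinity>" "bounded (limiting_subdiff F a)" "a \<in> edom \<phi>"
    and "stationarity_measure \<gamma>' F \<phi> a = 0" "0 < \<gamma>" "\<gamma> \<le> \<gamma>'"
  shows "stationarity_measure \<gamma> F \<phi> a = 0"
proof -
  obtain s where s: "\<phi> a = ereal s"
    using assms(2)[of a] assms(4) by (cases "\<phi> a") (auto simp: edom_def)
  note zero_iff = stationarity_measure_eq_0_iff[OF assms(1-3)] mem_prox_iff_minorant[of \<phi>, OF s]
  have "\<gamma>' > 0" using assms by simp
  then obtain v where v: "v \<in> limiting_subdiff F a"
      "\<And>y. ereal (s - v \<bullet> (y - a) - 1 / (2 * \<gamma>') * (norm (y - a))\<^sup>2) \<le> \<phi> y"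
    using assms(5) zero_iff by blast
  have "1 / (2 * \<gamma>') \<le> 1 / (2 * \<gamma>)" using assms(6,7) by (simp add: field_simps)
  then have "s - v \<bullet> (y - a) - 1 / (2 * \<gamma>) * (norm (y - a))\<^sup>2
      \<le> s - v \<bullet> (y - a) - 1 / (2 * \<gamma>') * (norm (y - a))\<^sup>2" for y
    using mult_right_mono[of "1 / (2 * \<gamma>')" "1 / (2 * \<gamma>)" "(norm (y - a))\<^sup>2"] by simp
  then have "\<forall>y. ereal (s - v \<bullet> (y - a) - 1 / (2 * \<gamma>) * (norm (y - a))\<^sup>2) \<le> \<phi> y"
    using v(2) by (meson ereal_less_eq(3) order_trans)
  then show ?thesis using zero_iff assms(6) v(1) by blast
qed

section \<open>Minimisation by compactness and the limiting sum rule\<close>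

text \<open>Lower semicontinuity is demanded only along sequences whose values converge in
  \<open>ereal\<close>, possibly to an infinite limit; this is what a minimising sequence
  offers.\<close>

lemma lsc_attains_inf:
  fixes G :: "'b::metric_space \<Rightarrow> ereal"
  assumes "compact K" "K \<noteq> {}"
    and "\<And>z a l. (\<And>n. z n \<in> K) \<Longrightarrow> a \<in> K \<Longrightarrow> z \<longlonglongrightarrow> a \<Longrightarrow> (\<lambda>n. G (z n)) \<longlonglongrightarrow> l \<Longrightarrow> G a \<le> l"
  shows "\<exists>p\<in>K. \<forall>q\<in>K. G p \<le> G q"
proof -
  obtain u where u: "\<And>n. u n \<in> G ` K" "u \<longlonglongrightarrow> Inf (G ` K)"
    using Inf_as_limit[of "G ` K"] assms(2) by blast
  then have "\<forall>n. \<exists>z. z \<in> K \<and> u n = G z" by blast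
  then obtain z where z: "\<And>n. z n \<in> K" "\<And>n. u n = G (z n)" by metis
  obtain p \<rho> where p: "p \<in> K" "strict_mono \<rho>" "(z \<circ> \<rho>) \<longlonglongrightarrow> p"
    using seq_compactE[of K z] assms(1) z(1) unfolding compact_eq_seq_compact_metric by blast
  have "(\<lambda>n. G (z (\<rho> n))) \<longlonglongrightarrow> Inf (G ` K)"
    using LIMSEQ_subseq_LIMSEQ[OF u(2) p(2)] by (simp add: comp_def z(2))
  then have "G p \<le> Inf (G ` K)"
    using assms(3)[of "\<lambda>n. z (\<rho> n)" p] z(1) p by (simp add: comp_def)
  then show ?thesis using p(1) by (blast intro: order_trans INF_lower)
qed

lemma lsc_add_continuous_attains_inf:
  fixes h :: "'a::euclidean_space \<times> 'a \<Rightarrow> real"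
  assumes "lower_semicontinuous \<phi>" "compact K" "K \<noteq> {}" "continuous_on K h"
  shows "\<exists>p\<in>K. \<forall>q\<in>K. ereal (h p) + \<phi> (snd p) \<le> ereal (h q) + \<phi> (snd q)"
proof (rule lsc_attains_inf[OF assms(2,3)])
  fix z a l
  assume z: "\<And>n. z n \<in> K" "a \<in> K" "z \<longlonglongrightarrow> a" "(\<lambda>n. ereal (h (z n)) + \<phi> (snd (z n))) \<longlonglongrightarrow> l"
  have h: "(\<lambda>n. ereal (- h (z n))) \<longlonglongrightarrow> ereal (- h a)"
    using continuous_on_tendsto_compose[OF assms(4) z(3,2)] z(1) by (intro tendsto_intros) simp
  \<comment> \<open>Adding back \<open>- h\<close>, which is finite and continuous, isolates
    \<open>\<phi>\<close>; an infinite \<open>l\<close> does no harm in this sum.\<close>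
  have "(\<lambda>n. (ereal (h (z n)) + \<phi> (snd (z n))) + ereal (- h (z n))) \<longlonglongrightarrow> l + ereal (- h a)"
    by (intro tendsto_add_ereal_general z(4) h) auto
  moreover have "(ereal (h (z n)) + \<phi> (snd (z n))) + ereal (- h (z n)) = \<phi> (snd (z n))" for n
    by (cases "\<phi> (snd (z n))") auto
  ultimately have "(\<lambda>n. \<phi> (snd (z n))) \<longlonglongrightarrow> l + ereal (- h a)" by simp
  then have "\<phi> (snd a) \<le> l + ereal (- h a)"
    using lsc_le_limit[OF assms(1) tendsto_snd[OF z(3)]] by blast
  then show "ereal (h a) + \<phi> (snd a) \<le> l"
    by (cases l; cases "\<phi> (snd a)") auto
qed

text \<open>
  Doubling of variables: \<open>f y + \<phi> z\<close> is minimised under the coupling penalty \<open>k * \<parallel>y - z\<parallel>\<^sup>2\<close>. The term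
  \<open>(2 * e / r) * \<parallel>z - a\<parallel>\<^sup>2\<close> beats the Frechet error \<open>e * \<parallel>z - a\<parallel>\<close> near the sphere of radius \<open>r\<close>, which
  forces the minimiser into the interior, while its gradient there is at most \<open>4 * e\<close>.
\<close>

lemma fuzzy_sum_rule:
  fixes f :: "'a::euclidean_space \<Rightarrow> real"
  assumes U: "open U" "a \<in> U" "L-lipschitz_on U f" and F: "\<And>y. y \<in> U \<Longrightarrow> F y = ereal (f y)"
    and lsc: "lower_semicontinuous \<phi>" and range: "\<And>y. \<phi> y \<noteq> -\<infinity>" and s: "\<phi> a = ereal s"
    and stationary: "0 \<in> frechet_subdiff (\<lambda>y. F y + \<phi> y) a" and "\<epsilon> > 0"
  shows "\<exists>y z v w. y \<in> U \<and> dist y a < \<epsilon> \<and> dist z a < \<epsilon> \<and> \<phi> z \<le> \<phi> a + ereal \<epsilon> \<and>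
    v \<in> frechet_subdiff F y \<and> w \<in> frechet_subdiff \<phi> z \<and> norm (v + w) < \<epsilon>"
proof -
  \<comment> \<open>One fifth, because the final bound on \<open>norm (v + w)\<close> is
    \<open>4 * e\<close>, strictly below \<open>\<epsilon>\<close>.\<close>
  define e where "e = \<epsilon> / 5"
  have "e > 0" using \<open>\<epsilon> > 0\<close> by (simp add: e_def)
  have L: "L \<ge> 0" using lipschitz_on_nonneg[OF U(3)] .
  have sum_a: "F a + \<phi> a = ereal (f a + s)" using F[OF U(2)] s by simp
  obtain \<delta> where \<delta>: "\<delta> > 0"
    "\<And>y. y \<in> ball a \<delta> \<Longrightarrow> ereal (f a + s - e * norm (y - a)) \<le> F y + \<phi> y"
    using stationary \<open>e > 0\<close>
    unfolding frechet_subdiff_iff[of "\<lambda>y. F y + \<phi> y", OF sum_a] by auto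
  obtain R where R: "R > 0" "ball a R \<subseteq> U" using U(1,2) openE by blast
  \<comment> \<open>The first two bounds keep the closed ball inside \<open>U\<close> and
    \<open>ball a \<delta>\<close>; the last gives both \<open>r \<le> \<epsilon>\<close> and
    \<open>L * r \<le> \<epsilon>\<close>.\<close>
  define r where "r = min (min (R / 2) (\<delta> / 2)) (\<epsilon> / (L + 1))"
  have "\<epsilon> / (L + 1) > 0" using \<open>\<epsilon> > 0\<close> L by simp
  then have r: "r > 0" "r < R" "r < \<delta>" "r \<le> \<epsilon> / (L + 1)"
    using R(1) \<delta>(1) by (simp_all add: r_def min_less_iff_disj)
  have "r * (L + 1) \<le> \<epsilon>" using r(4) L by (simp add: field_simps)
  moreover have "0 \<le> r * L" using r(1) L by simp
  ultimately have r_le: "r \<le> \<epsilon>" "L * r \<le> \<epsilon>"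
    using r(1) by (auto simp: algebra_simps)
  have cball_U: "cball a r \<subseteq> U" and cball_\<delta>: "cball a r \<subseteq> ball a \<delta>" using R(2) r(2,3) by auto
  \<comment> \<open>For the minimiser, \<open>k * \<tau> \<le> L\<close> will hold with
    \<open>\<tau> = norm (y - z)\<close>; the two summands then force
    \<open>L * \<tau> < e * r / 4\<close> and \<open>\<tau> < r / 8\<close> respectively.\<close>
  define k where "k = 4 * (L\<^sup>2 + 1) / (e * r) + 8 * (L + 1) / r"
  have k_parts: "4 * (L\<^sup>2 + 1) / (e * r) > 0" "8 * (L + 1) / r > 0"
    using \<open>e > 0\<close> r(1) L by (auto intro!: divide_pos_pos mult_pos_pos add_nonneg_pos)
  then have k_ge: "4 * (L\<^sup>2 + 1) / (e * r) \<le> k" "8 * (L + 1) / r \<le> k" and k: "k > 0"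
    by (auto simp: k_def)
  define h where "h = (\<lambda>(y, z). f y + 2 * e / r * (norm (z - a))\<^sup>2 + k * (norm (y - z))\<^sup>2)"
  have "continuous_on (cball a r) f"
    using lipschitz_on_continuous_on[OF U(3)] cball_U continuous_on_subset by blast
  then have "continuous_on (cball a r \<times> cball a r) (\<lambda>p. f (fst p))"
    by (rule continuous_on_compose2) (auto intro!: continuous_intros)
  then have "continuous_on (cball a r \<times> cball a r) h"
    unfolding h_def case_prod_unfold by (intro continuous_intros)
  moreover have "compact (cball a r \<times> cball a r)" "cball a r \<times> cball a r \<noteq> {}"
    using r(1) by (auto intro: compact_Times)
  ultimately obtain p where "p \<in> cball a r \<times> cball a r"
    and p: "\<And>q. q \<in> cball a r \<times> cball a r \<Longrightarrow> ereal (h p) + \<phi> (snd p) \<le> ereal (h q) + \<phi> (snd q)"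
    using lsc_add_continuous_attains_inf[OF lsc, of "cball a r \<times> cball a r" h] by metis
  then obtain y z where yz: "y \<in> cball a r" "z \<in> cball a r" and
    min: "\<And>y' z'. y' \<in> cball a r \<Longrightarrow> z' \<in> cball a r \<Longrightarrow>
      ereal (h (y, z)) + \<phi> z \<le> ereal (h (y', z')) + \<phi> z'"
    by (cases p) auto
  have "ereal (h (y, z)) + \<phi> z \<le> ereal (h (a, a)) + ereal s"
    using min[of a a] r(1) s by simp
  then obtain t where t: "\<phi> z = ereal t" "h (y, z) + t \<le> h (a, a) + s"
    using range[of z] by (cases "\<phi> z") auto
  define \<tau> \<sigma> where "\<tau> = norm (y - z)" and "\<sigma> = norm (z - a)"
  have nonneg: "\<tau> \<ge> 0" "\<sigma> \<ge> 0" "\<sigma> \<le> r"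
    using yz(2) by (auto simp: \<tau>_def \<sigma>_def dist_norm norm_minus_commute)
  have upper: "f y + 2 * e / r * \<sigma>\<^sup>2 + k * \<tau>\<^sup>2 + t \<le> f a + s"
    using t(2) by (simp add: h_def \<tau>_def \<sigma>_def)
  have f_lip: "f u \<le> f u' + L * norm (u - u')" if "u \<in> cball a r" "u' \<in> cball a r" for u u'
  proof -
    have "\<bar>f u - f u'\<bar> \<le> L * norm (u - u')"
      using lipschitz_on_normD[OF U(3), of u u'] that cball_U unfolding real_norm_def by blast
    then show ?thesis by linarith
  qed
  \<comment> \<open>The competitor \<open>(z, z)\<close> has no coupling cost, so the coupling
    penalty is at most the Lipschitz variation of \<open>f\<close>.\<close>
  have "f y + k * \<tau>\<^sup>2 \<le> f z"
    using min[OF yz(2) yz(2)] t(1) by (simp add: h_def \<tau>_def)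
  also have "f z \<le> f y + L * \<tau>"
    using f_lip[OF yz(2,1)] by (simp add: \<tau>_def norm_minus_commute)
  finally have "\<tau> * (k * \<tau>) \<le> \<tau> * L" by (simp add: power2_eq_square algebra_simps)
  then have k\<tau>: "k * \<tau> \<le> L" using nonneg(1) L by (cases "\<tau> = 0") auto
  have "8 * (L + 1) * \<tau> / r \<le> k * \<tau>"
    using mult_right_mono[OF k_ge(2) nonneg(1)] by simp
  also note k\<tau>
  finally have "8 * (L + 1) * \<tau> \<le> L * r" using r(1) by (simp only: pos_divide_le_eq)
  also have "\<dots> < (L + 1) * r" using r(1) by simp
  finally have "(L + 1) * (8 * \<tau>) < (L + 1) * r" by (simp add: algebra_simps)
  then have \<tau>: "\<tau> < r / 8" using L by simp
  have "4 * (L\<^sup>2 + 1) * \<tau> / (e * r) \<le> k * \<tau>"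
    using mult_right_mono[OF k_ge(1) nonneg(1)] by simp
  also note k\<tau>
  finally have "4 * (L\<^sup>2 + 1) * \<tau> \<le> L * (e * r)"
    using r(1) \<open>e > 0\<close> by (simp only: pos_divide_le_eq mult_pos_pos)
  then have "L * (4 * (L\<^sup>2 + 1) * \<tau>) \<le> L * (L * (e * r))" using L by (intro mult_left_mono) auto
  also have "\<dots> < (L\<^sup>2 + 1) * (e * r)"
    using r(1) \<open>e > 0\<close> by (simp add: power2_eq_square algebra_simps)
  finally have "(L\<^sup>2 + 1) * (4 * (L * \<tau>)) < (L\<^sup>2 + 1) * (e * r)" by (simp add: algebra_simps)
  then have L\<tau>: "L * \<tau> < e * r / 4"
    by (simp add: mult_less_cancel_left add_nonneg_pos)
  \<comment> \<open>Stationarity bounds the sum from below at \<open>z\<close>; against the upper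
    bound from the competitor \<open>(a, a)\<close> this leaves a quadratic inequality in
    \<open>\<sigma>\<close>.\<close>
  have "f a + s - e * \<sigma> \<le> f z + t"
  proof -
    have "z \<in> ball a \<delta>" "z \<in> U" using yz(2) cball_\<delta> cball_U by blast+
    then show ?thesis using \<delta>(2)[of z] F[of z] t(1) by (simp add: \<sigma>_def)
  qed
  also have "f z \<le> f y + L * \<tau>" by fact
  finally have "2 * e / r * \<sigma>\<^sup>2 - e * \<sigma> \<le> L * \<tau>"
    using upper k zero_le_power2[of \<tau>] mult_nonneg_nonneg[of k "\<tau>\<^sup>2"] by linarith
  moreover have "2 * e / r * \<sigma>\<^sup>2 - e * \<sigma> = e * (2 * \<sigma>\<^sup>2 - r * \<sigma>) / r"
    using r(1) by (simp add: field_simps)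
  ultimately have "e * (2 * \<sigma>\<^sup>2 - r * \<sigma>) / r < e * r / 4"
    using L\<tau> by linarith
  then have "e * (2 * \<sigma>\<^sup>2 - r * \<sigma>) < e * r / 4 * r"
    using r(1) by (simp only: pos_divide_less_eq)
  then have "e * (2 * \<sigma>\<^sup>2 - r * \<sigma>) < e * (r\<^sup>2 / 4)"
    by (simp add: power2_eq_square)
  then have \<sigma>_sq: "2 * \<sigma>\<^sup>2 - r * \<sigma> < r\<^sup>2 / 4" using \<open>e > 0\<close> by simp
  have \<sigma>: "\<sigma> < 3 / 4 * r"
  proof (rule ccontr)
    assume "\<not> \<sigma> < 3 / 4 * r"
    \<comment> \<open>The product expands to
      \<open>2 * \<sigma>\<^sup>2 - r * \<sigma> - 3 / 8 * r\<^sup>2\<close>.\<close>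
    then have "0 \<le> (\<sigma> - 3 / 4 * r) * (2 * \<sigma> + r / 2)" using nonneg r(1) by simp
    then have "r\<^sup>2 * 3 / 8 \<le> 2 * \<sigma>\<^sup>2 - r * \<sigma>" by (simp add: power2_eq_square algebra_simps)
    moreover have "r\<^sup>2 / 4 < r\<^sup>2 * 3 / 8" using r(1) by simp
    ultimately show False using \<sigma>_sq by linarith
  qed
  have "norm (y - a) \<le> \<tau> + \<sigma>"
    using norm_triangle_ineq[of "y - z" "z - a"] by (simp add: \<tau>_def \<sigma>_def)
  then have y: "y \<in> ball a r" and z: "z \<in> ball a r"
    using \<tau> \<sigma> r(1) by (auto simp: dist_norm norm_minus_commute \<sigma>_def)
  \<comment> \<open>\<open>v\<close> and \<open>w\<close> are the negative partial gradients of the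
    penalty terms at the minimiser; the coupling parts cancel in \<open>v + w\<close>.\<close>
  define v where "v = - (2 * k) *\<^sub>R (y - z)"
  define w where "w = (2 * k) *\<^sub>R (y - z) - (4 * e / r) *\<^sub>R (z - a)"
  have "v \<in> proximal_subdiff F y"
  proof (rule proximal_subdiffI[where V = "ball a r" and c = k and r = "f y"])
    show "F y = ereal (f y)" using F yz(1) cball_U by blast
    fix y' assume y': "y' \<in> ball a r"
    have "f y + k * \<tau>\<^sup>2 \<le> f y' + k * (norm (y' - z))\<^sup>2"
      using min[of y' z] y' yz(2) t(1) by (simp add: h_def \<tau>_def)
    then have "f y + v \<bullet> (y' - y) - k * (norm (y' - y))\<^sup>2 \<le> f y'"
      unfolding power2_norm_diff_expand[of y' z y] by (simp add: v_def \<tau>_def algebra_simps)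
    then show "ereal (f y + v \<bullet> (y' - y) - k * (norm (y' - y))\<^sup>2) \<le> F y'"
      using F[of y'] y' cball_U ball_subset_cball[of a r] by (simp add: subset_iff)
  qed (use y in auto)
  moreover have "F y = ereal (f y)" using F yz(1) cball_U by blast
  ultimately have "v \<in> frechet_subdiff F y"
    using proximal_subdiff_subset_frechet by blast
  have "w \<in> proximal_subdiff \<phi> z"
  proof (rule proximal_subdiffI[where V = "ball a r" and c = "2 * e / r + k" and r = t])
    fix z' assume z': "z' \<in> ball a r"
    have *: "ereal (h (y, z)) + ereal t \<le> ereal (h (y, z')) + \<phi> z'"
      using min[of y z'] z' yz(1) t(1) by simp
    show "ereal (t + w \<bullet> (z' - z) - (2 * e / r + k) * (norm (z' - z))\<^sup>2) \<le> \<phi> z'"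
    proof (cases "\<phi> z'")
      case (real t')
      with * have "h (y, z) + t \<le> h (y, z') + t'" by simp
      moreover have "h (y, z') = h (y, z) + 2 * e / r * (2 * ((z - a) \<bullet> (z' - z)) + (norm (z' - z))\<^sup>2)
          + k * (- 2 * ((y - z) \<bullet> (z' - z)) + (norm (z' - z))\<^sup>2)"
        unfolding h_def prod.case norm_minus_commute[of y] 
          power2_norm_diff_expand[of z' a z] power2_norm_diff_expand[of z' y z]
        by (simp add: algebra_simps inner_diff_left)
      ultimately show ?thesis
        unfolding real by (simp add: w_def inner_diff_left algebra_simps)
    qed (use range in auto)
  qed (use z t in auto)
  then have "w \<in> frechet_subdiff \<phi> z"
    using proximal_subdiff_subset_frechet[of \<phi>, OF t(1)] by blast
  have "v + w = - (4 * e / r) *\<^sub>R (z - a)" by (simp add: v_def w_def)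
  then have "norm (v + w) = 4 * e / r * \<sigma>"
    using \<open>e > 0\<close> r(1) by (simp add: \<sigma>_def)
  also have "\<dots> \<le> 4 * e / r * r" using \<open>e > 0\<close> r(1) nonneg(3) by (intro mult_left_mono) auto
  also have "\<dots> < \<epsilon>" using r(1) \<open>\<epsilon> > 0\<close> by (simp add: e_def)
  finally have "norm (v + w) < \<epsilon>" .
  \<comment> \<open>A lower bound on \<open>f y\<close> turns the upper bound on the whole objective
    into the estimate of \<open>\<phi> z\<close>.\<close>
  have "f a \<le> f y + L * r"
  proof -
    have "f a \<le> f y + L * norm (a - y)" using f_lip[of a y] yz(1) r(1) by simp
    also have "L * norm (a - y) \<le> L * r"
      using yz(1) L by (intro mult_left_mono) (auto simp: dist_norm)
    finally show ?thesis by simp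
  qed
  moreover have "0 \<le> 2 * e / r * \<sigma>\<^sup>2" "0 \<le> k * \<tau>\<^sup>2" using \<open>e > 0\<close> r(1) k by auto
  ultimately have "t \<le> s + \<epsilon>" using upper r_le(2) by linarith
  then have "\<phi> z \<le> \<phi> a + ereal \<epsilon>" by (simp add: t(1) s)
  then show ?thesis
    using y z yz(1) cball_U r_le(1) \<open>v \<in> frechet_subdiff F y\<close> \<open>w \<in> frechet_subdiff \<phi> z\<close> \<open>norm (v + w) < \<epsilon>\<close>
    by (intro exI[of _ y] exI[of _ z] exI[of _ v] exI[of _ w]) (auto simp: dist_commute)
qed

text \<open>The fuzzy rule is applied with tolerances tending to zero. The Lipschitz constant bounds
  the subgradients of \<open>F\<close>, so a subsequence converges to some \<open>u\<close>; those
  of \<open>\<phi>\<close> then tend to \<open>- u\<close> because the sums vanish in the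
  limit.\<close>

lemma limiting_sum_rule:
  fixes f :: "'a::euclidean_space \<Rightarrow> real"
  assumes U: "open U" "a \<in> U" "L-lipschitz_on U f" and F: "\<And>y. y \<in> U \<Longrightarrow> F y = ereal (f y)"
    and lsc: "lower_semicontinuous \<phi>" and range: "\<And>y. \<phi> y \<noteq> -\<infinity>" and dom: "a \<in> edom \<phi>"
    and stationary: "0 \<in> frechet_subdiff (\<lambda>y. F y + \<phi> y) a"
  shows "\<exists>v\<in>limiting_subdiff F a. - v \<in> limiting_subdiff \<phi> a"
proof -
  obtain s where s: "\<phi> a = ereal s"
    using range[of a] dom by (cases "\<phi> a") (auto simp: edom_def)
  have "\<exists>y z v w. y \<in> U \<and> dist y a < inverse (real (Suc n)) \<and> dist z a < inverse (real (Suc n)) \<and>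
    \<phi> z \<le> \<phi> a + ereal (inverse (real (Suc n))) \<and>
    v \<in> frechet_subdiff F y \<and> w \<in> frechet_subdiff \<phi> z \<and> norm (v + w) < inverse (real (Suc n))" for n
    by (rule fuzzy_sum_rule[OF U F lsc range s stationary]) auto
  then obtain y z v w where y: "\<And>n. y n \<in> U" "\<And>n. dist (y n) a < inverse (real (Suc n))"
    and z: "\<And>n. dist (z n) a < inverse (real (Suc n))"
      "\<And>n. \<phi> (z n) \<le> \<phi> a + ereal (inverse (real (Suc n)))"
    and v: "\<And>n. v n \<in> frechet_subdiff F (y n)" and w: "\<And>n. w n \<in> frechet_subdiff \<phi> (z n)"
    and vw: "\<And>n. norm (v n + w n) < inverse (real (Suc n))"
    by metis
  have inv: "(\<lambda>n. inverse (real (Suc n))) \<longlonglongrightarrow> 0"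
    by (rule LIMSEQ_inverse_real_of_nat)
  have y_lim: "y \<longlonglongrightarrow> a" and z_lim: "z \<longlonglongrightarrow> a"
    unfolding tendsto_dist_iff[of _ a]
    by (rule Lim_null_comparison[OF _ inv]; simp add: y(2) z(1) less_imp_le del: of_nat_Suc)+
  have vw_lim: "(\<lambda>n. v n + w n) \<longlonglongrightarrow> 0"
    by (rule Lim_null_comparison[OF _ inv]) (simp add: vw less_imp_le del: of_nat_Suc)
  have "v n \<in> cball 0 L" for n
    using norm_frechet_subdiff_le_lipschitz[OF U(1) y(1) U(3) F v] by simp
  then obtain u \<rho> where \<rho>: "strict_mono \<rho>" and "(v \<circ> \<rho>) \<longlonglongrightarrow> u"
    using seq_compactE[of "cball 0 L" v] compact_cball[of "0::'a" L]
    unfolding compact_eq_seq_compact_metric by blast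
  then have v_lim: "(\<lambda>n. v (\<rho> n)) \<longlonglongrightarrow> u" by (simp add: comp_def)
  have "(\<lambda>n. (v (\<rho> n) + w (\<rho> n)) - v (\<rho> n)) \<longlonglongrightarrow> 0 - u"
    using LIMSEQ_subseq_LIMSEQ[OF vw_lim \<rho>] v_lim by (intro tendsto_diff) (simp_all add: comp_def)
  then have w_lim: "(\<lambda>n. w (\<rho> n)) \<longlonglongrightarrow> - u" by simp
  \<comment> \<open>Limiting subgradients also demand convergence of the function values; for
    \<open>F\<close> continuity of \<open>f\<close> gives it.\<close>
  have "isCont f a"
    using lipschitz_on_continuous_on[OF U(3)] U(1,2) continuous_on_eq_continuous_at by blast
  then have "(\<lambda>n. ereal (f (y n))) \<longlonglongrightarrow> ereal (f a)"
    using y_lim isCont_tendsto_compose by (intro tendsto_ereal) blast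
  then have F_lim: "(\<lambda>n. F (y n)) \<longlonglongrightarrow> F a"
    by (simp add: F[OF U(2)] F[OF y(1)])
  \<comment> \<open>The upper half comes from the fuzzy rule, the lower half from lower
    semicontinuity.\<close>
  have \<phi>_lim: "(\<lambda>n. \<phi> (z n)) \<longlonglongrightarrow> \<phi> a"
  proof (rule order_tendstoI)
    fix c assume "\<phi> a < c"
    have "(\<lambda>n. ereal (s + inverse (real (Suc n)))) \<longlonglongrightarrow> ereal (s + 0)"
      by (intro tendsto_intros inv)
    then have "\<forall>\<^sub>F n in sequentially. ereal (s + inverse (real (Suc n))) < c"
      by (rule order_tendstoD) (use \<open>\<phi> a < c\<close> s in simp)
    then show "\<forall>\<^sub>F n in sequentially. \<phi> (z n) < c"
      by eventually_elim (use z(2) s in \<open>auto intro: order_le_less_trans\<close>)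
  qed (rule lsc_eventually_less[OF lsc z_lim])
  have "a \<in> edom F" using F[OF U(2)] by (simp add: edom_def)
  have "u \<in> limiting_subdiff F a"
    unfolding limiting_subdiff_def
    using LIMSEQ_subseq_LIMSEQ[OF y_lim \<rho>] LIMSEQ_subseq_LIMSEQ[OF F_lim \<rho>] v_lim v \<open>a \<in> edom F\<close>
    by (intro CollectI conjI exI[of _ "\<lambda>n. y (\<rho> n)"] exI[of _ "\<lambda>n. v (\<rho> n)"]) (simp_all add: comp_def)
  moreover have "- u \<in> limiting_subdiff \<phi> a"
    unfolding limiting_subdiff_def
    using LIMSEQ_subseq_LIMSEQ[OF z_lim \<rho>] LIMSEQ_subseq_LIMSEQ[OF \<phi>_lim \<rho>] w_lim w dom
    by (intro CollectI conjI exI[of _ "\<lambda>n. z (\<rho> n)"] exI[of _ "\<lambda>n. w (\<rho> n)"]) (simp_all add: comp_def)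
  ultimately show ?thesis by blast
qed

section \<open>Functions with locally Lipschitz gradient\<close>

text \<open>\<open>adjoint f' 1\<close> is the Riesz vector of the derivative; uniqueness of
  derivatives then justifies the definite description in \<open>gradient\<close>.\<close>

lemma GDERIV_gradient:
  fixes f :: "'a::euclidean_space \<Rightarrow> real"
  assumes "f differentiable (at y)"
  shows "GDERIV f y :> gradient f y"
proof -
  obtain f' where f': "(f has_derivative f') (at y)" using assms by (auto simp: differentiable_def)
  have "f' = (\<lambda>h. h \<bullet> adjoint f' 1)"
    using adjoint_works[OF has_derivative_linear[OF f'], of _ 1] by simp
  then have D: "GDERIV f y :> adjoint f' 1" using f' by (simp add: gderiv_def)
  have "D' = adjoint f' 1" if "GDERIV f y :> D'" for D'
  proof -
    have "(\<lambda>h. h \<bullet> D') = (\<lambda>h. h \<bullet> adjoint f' 1)"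
      using has_derivative_unique that D unfolding gderiv_def by blast
    then have "h \<bullet> D' = h \<bullet> adjoint f' 1" for h by (rule fun_cong)
    then show ?thesis by (metis vector_eq_ldot)
  qed
  then show ?thesis unfolding gradient_def by (rule theI[where P = "\<lambda>D. GDERIV f y :> D", OF D])
qed

text \<open>Mean value estimate on the segment for \<open>f\<close> minus its linear part at
  \<open>a\<close>: the derivative at \<open>u\<close> is a difference of gradients, of norm at most
  \<open>K * norm (u - a)\<close>.\<close>

lemma gradient_quadratic_bound:
  fixes f :: "'a::euclidean_space \<Rightarrow> real"
  assumes "open V" "\<And>y. y \<in> V \<Longrightarrow> f differentiable (at y)"
    and "locally_lipschitz_at V (gradient f) a"
  shows "\<exists>K. \<exists>\<delta>>0. ball a \<delta> \<subseteq> V \<and>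
    (\<forall>y\<in>ball a \<delta>. \<bar>f y - f a - gradient f a \<bullet> (y - a)\<bar> \<le> K * (norm (y - a))\<^sup>2)"
proof -
  obtain U K where U: "open U" "a \<in> U" "U \<subseteq> V" "K-lipschitz_on U (gradient f)"
    using assms(3) unfolding locally_lipschitz_at_def by blast
  have K: "K \<ge> 0" using lipschitz_on_nonneg[OF U(4)] .
  obtain \<delta> where \<delta>: "\<delta> > 0" "ball a \<delta> \<subseteq> U" using U(1,2) openE by blast
  have "\<bar>f y - f a - gradient f a \<bullet> (y - a)\<bar> \<le> K * (norm (y - a))\<^sup>2" if y: "y \<in> ball a \<delta>" for y
  proof -
    let ?S = "closed_segment a y"
    have S: "?S \<subseteq> ball a \<delta>" using y \<delta>(1) by (intro closed_segment_subset) auto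
    have "norm ((f y - gradient f a \<bullet> y) - (f a - gradient f a \<bullet> a)) \<le> K * norm (y - a) * norm (y - a)"
    proof (rule differentiable_bound[where S = ?S and
          f' = "\<lambda>u h. h \<bullet> gradient f u - gradient f a \<bullet> h"])
      fix u assume u: "u \<in> ?S"
      then have "u \<in> U" using S \<delta>(2) by blast
      then have "GDERIV f u :> gradient f u" using U(3) assms(2) GDERIV_gradient by blast
      then have "(f has_derivative (\<lambda>h. h \<bullet> gradient f u)) (at u within ?S)"
        unfolding gderiv_def by (rule has_derivative_at_withinI)
      then show "((\<lambda>y. f y - gradient f a \<bullet> y) has_derivative
          (\<lambda>h. h \<bullet> gradient f u - gradient f a \<bullet> h)) (at u within ?S)"
        by (auto intro!: derivative_eq_intros)
      show "onorm (\<lambda>h. h \<bullet> gradient f u - gradient f a \<bullet> h) \<le> K * norm (y - a)"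
      proof (rule onorm_le)
        fix h :: 'a
        have "norm (gradient f u - gradient f a) \<le> K * norm (u - a)"
          using lipschitz_on_normD[OF U(4) \<open>u \<in> U\<close> U(2)] .
        also have "\<dots> \<le> K * norm (y - a)"
          using segment_bound(1)[OF u] K by (intro mult_left_mono)
        finally have "norm h * norm (gradient f u - gradient f a) \<le> norm h * (K * norm (y - a))"
          by (intro mult_left_mono) auto
        moreover have "h \<bullet> gradient f u - gradient f a \<bullet> h = h \<bullet> (gradient f u - gradient f a)"
          by (simp add: inner_diff_right inner_commute)
        ultimately show "norm (h \<bullet> gradient f u - gradient f a \<bullet> h) \<le> K * norm (y - a) * norm h"
          using Cauchy_Schwarz_ineq2[of h "gradient f u - gradient f a"] by (simp add: mult_ac)
      qed
    qed auto
    then show ?thesis by (simp add: power2_eq_square algebra_simps)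
  qed
  then show ?thesis using \<delta> U(3) by blast
qed

text \<open>The quadratic bound is two-sided, so it supports \<open>F\<close> and, after a change of
  sign, \<open>- F\<close>.\<close>

lemma proximal_subdiff_gradient:
  fixes f :: "'a::euclidean_space \<Rightarrow> real"
  assumes "open V" "a \<in> V" "\<And>y. y \<in> V \<Longrightarrow> f differentiable (at y)"
    and "locally_lipschitz_at V (gradient f) a" "\<And>y. y \<in> V \<Longrightarrow> F y = ereal (f y)"
  shows "gradient f a \<in> proximal_subdiff F a"
    and "- gradient f a \<in> proximal_subdiff (\<lambda>y. - F y) a"
proof -
  obtain K \<delta> where \<delta>: "\<delta> > 0" "ball a \<delta> \<subseteq> V"
    and K: "\<And>y. y \<in> ball a \<delta> \<Longrightarrow> \<bar>f y - f a - gradient f a \<bullet> (y - a)\<bar> \<le> K * (norm (y - a))\<^sup>2"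
    using gradient_quadratic_bound[OF assms(1,3,4)] by blast
  have F: "F y = ereal (f y)" if "y \<in> ball a \<delta>" for y using \<delta>(2) assms(5) that by blast
  show "gradient f a \<in> proximal_subdiff F a"
  proof (rule proximal_subdiffI[where V = "ball a \<delta>"])
    fix y assume "y \<in> ball a \<delta>"
    then show "ereal (f a + gradient f a \<bullet> (y - a) - K * (norm (y - a))\<^sup>2) \<le> F y"
      using K[of y] F[of y] by (simp add: abs_le_iff)
  qed (use \<delta> assms in auto)
  show "- gradient f a \<in> proximal_subdiff (\<lambda>y. - F y) a"
  proof (rule proximal_subdiffI[where V = "ball a \<delta>"])
    fix y assume "y \<in> ball a \<delta>"
    then show "ereal (- f a + - gradient f a \<bullet> (y - a) - K * (norm (y - a))\<^sup>2) \<le> - F y"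
      using K[of y] F[of y] by (simp add: abs_le_iff)
  qed (use \<delta> assms in auto)
qed

text \<open>Adding \<open>- gradient f y\<close>, a Frechet subgradient of \<open>- F\<close>, to
  any Frechet subgradient of \<open>F\<close> must give zero; continuity of the gradient then
  settles the limits.\<close>

lemma limiting_subdiff_eq_gradient:
  fixes f :: "'a::euclidean_space \<Rightarrow> real"
  assumes "open V" "a \<in> V" "\<And>y. y \<in> V \<Longrightarrow> f differentiable (at y)"
    and lip: "\<And>y. y \<in> V \<Longrightarrow> locally_lipschitz_at V (gradient f) y"
    and F: "\<And>y. y \<in> V \<Longrightarrow> F y = ereal (f y)"
  shows "limiting_subdiff F a = {gradient f a}"
proof
  have frechet: "w = gradient f y" if "y \<in> V" "w \<in> frechet_subdiff F y" for y w
  proof -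
    have neg: "- F y = ereal (- f y)" using F that(1) by simp
    have "- gradient f y \<in> frechet_subdiff (\<lambda>y. - F y) y"
      using proximal_subdiff_gradient(2)[OF assms(1) that(1) assms(3) lip[OF that(1)] F]
        proximal_subdiff_subset_frechet[of "\<lambda>y. - F y", OF neg] by blast
    then have "w + - gradient f y \<in> frechet_subdiff (\<lambda>y. F y + - F y) y"
      using frechet_subdiff_add[of F, OF F[OF that(1)], of "\<lambda>y. - F y", OF neg] that(2) by blast
    \<comment> \<open>\<open>F + - F\<close> vanishes on \<open>V\<close>, so its subgradients are bounded by the Lipschitz constant 0.\<close>
    then have "norm (w + - gradient f y) \<le> 0"
      by (rule norm_frechet_subdiff_le_lipschitz[OF assms(1) that(1) lipschitz_on_constant[of V 0], rotated])
        (simp add: F)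
    then show ?thesis by simp
  qed
  show "limiting_subdiff F a \<subseteq> {gradient f a}"
  proof
    fix v assume "v \<in> limiting_subdiff F a"
    then obtain x w where xw: "x \<longlonglongrightarrow> a" "\<And>n. w n \<in> frechet_subdiff F (x n)" "w \<longlonglongrightarrow> v"
      unfolding limiting_subdiff_def by blast
    obtain U K where U: "open U" "a \<in> U" "K-lipschitz_on U (gradient f)"
      using lip[OF assms(2)] unfolding locally_lipschitz_at_def by blast
    have "isCont (gradient f) a"
      using lipschitz_on_continuous_on[OF U(3)] U(1,2) continuous_on_eq_continuous_at by blast
    then have "(\<lambda>n. gradient f (x n)) \<longlonglongrightarrow> gradient f a"
      using xw(1) isCont_tendsto_compose by blast
    \<comment> \<open>The identification with the gradient applies only once \<open>x n\<close> lies
      in \<open>V\<close>.\<close>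
    moreover have "\<forall>\<^sub>F n in sequentially. gradient f (x n) = w n"
      using topological_tendstoD[OF xw(1) assms(1,2)] by eventually_elim (use frechet xw(2) in metis)
    ultimately have "w \<longlonglongrightarrow> gradient f a" by (rule Lim_transform_eventually)
    then show "v \<in> {gradient f a}" using xw(3) LIMSEQ_unique by blast
  qed
  show "{gradient f a} \<subseteq> limiting_subdiff F a"
    using proximal_subdiff_gradient(1)[OF assms(1-3) lip[OF assms(2)] F]
      proximal_subdiff_subset_frechet[of F, OF F[OF assms(2)]] frechet_subdiff_subset_limiting by blast
qed

section \<open>Prox-regularity, the exact sum rule and the equivalences\<close>

text \<open>Prox-regularity is read at the base point itself, with \<open>x = a\<close> and
  \<open>v = w\<close>; finiteness of \<open>\<phi> a\<close> makes the condition on the values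
  strict.\<close>

lemma prox_regular_imp_proximal_subdiff:
  assumes "prox_regular_at \<phi> a" "\<phi> a = ereal s" "w \<in> limiting_subdiff \<phi> a"
  shows "w \<in> proximal_subdiff \<phi> a"
proof -
  obtain \<delta> \<eta> where \<delta>: "\<delta> > 0" and reg: "\<forall>x\<in>ball a \<delta>. \<forall>v\<in>limiting_subdiff \<phi> x \<inter> ball w \<delta>.
      \<phi> x < \<phi> a + ereal \<delta> \<longrightarrow>
      (\<forall>x'\<in>ball a \<delta>. \<phi> x + ereal (v \<bullet> (x' - x) - \<eta> / 2 * (norm (x' - x))\<^sup>2) \<le> \<phi> x')"
    using assms(1,3) unfolding prox_regular_at_def prox_regular_at_for_def by blast
  have "\<phi> a < \<phi> a + ereal \<delta>" "a \<in> ball a \<delta>" "w \<in> limiting_subdiff \<phi> a \<inter> ball w \<delta>"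
    using \<delta> assms by auto
  then have "\<forall>y\<in>ball a \<delta>. \<phi> a + ereal (w \<bullet> (y - a) - \<eta> / 2 * (norm (y - a))\<^sup>2) \<le> \<phi> y"
    using reg by blast
  then show ?thesis
    unfolding proximal_subdiff_iff[of \<phi>, OF assms(2)] using \<delta>
    by (intro exI[of _ "\<eta> / 2"] exI[of _ \<delta>]) (simp add: assms(2) add_diff_eq)
qed

text \<open>Adding \<open>- F\<close> with its subgradient \<open>- gradient f a\<close> undoes the
  addition of \<open>F\<close>, so the sum rule can be reversed.\<close>

lemma proximal_subdiff_gradient_add_iff:
  fixes f :: "'a::euclidean_space \<Rightarrow> real"
  assumes "open V" "a \<in> V" "\<And>y. y \<in> V \<Longrightarrow> f differentiable (at y)"
    and "locally_lipschitz_at V (gradient f) a" and F: "\<And>y. y \<in> V \<Longrightarrow> F y = ereal (f y)"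
    and s: "\<phi> a = ereal s"
  shows "v \<in> proximal_subdiff (\<lambda>y. F y + \<phi> y) a \<longleftrightarrow> v - gradient f a \<in> proximal_subdiff \<phi> a"
proof
  note grad = proximal_subdiff_gradient[OF assms(1-4) F]
  have sum_a: "F a + \<phi> a = ereal (f a + s)" and neg: "- F a = ereal (- f a)"
    using F[OF assms(2)] s by auto
  {
    assume "v \<in> proximal_subdiff (\<lambda>y. F y + \<phi> y) a"
    then have *: "v + - gradient f a \<in> proximal_subdiff (\<lambda>y. (F y + \<phi> y) + - F y) a"
      using proximal_subdiff_add[of "\<lambda>y. F y + \<phi> y", OF sum_a, of "\<lambda>y. - F y", OF neg] grad(2) by blast
    \<comment> \<open>Cancellation requires \<open>F y\<close> to be finite, so it is claimed only
      on \<open>V\<close> and transferred to \<open>\<phi>\<close> locally.\<close>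
    have cancel: "(F y + \<phi> y) + - F y = \<phi> y" if "y \<in> V" for y
      using F[OF that] by (cases "\<phi> y") auto
    have "v + - gradient f a \<in> proximal_subdiff \<phi> a"
      by (rule proximal_subdiff_mono[of "\<lambda>y. (F y + \<phi> y) + - F y", OF _ _ assms(1,2) _ *]) (use cancel[OF assms(2)] cancel s in simp_all)
    then show "v - gradient f a \<in> proximal_subdiff \<phi> a" by simp
  }
  assume "v - gradient f a \<in> proximal_subdiff \<phi> a"
  then have "gradient f a + (v - gradient f a) \<in> proximal_subdiff (\<lambda>y. F y + \<phi> y) a"
    using proximal_subdiff_add[of F, OF F[OF assms(2)], of \<phi>, OF s] grad(1) by blast
  then show "v \<in> proximal_subdiff (\<lambda>y. F y + \<phi> y) a" by simp
qed

theorem proposition3p3: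
  fixes F \<phi> :: "'a::euclidean_space \<Rightarrow> ereal"
    and \<gamma>\<^sub>\<phi> :: ereal
    and x :: 'a
  assumes F_range: "\<And>y. F y \<noteq> - \<infinity>"
    and phi_range: "\<And>y. \<phi> y \<noteq> - \<infinity>"
    and F_proper: "proper F"
    and phi_proper: "proper \<phi>"
    and F_lsc: "lower_semicontinuous F"
    and phi_lsc: "lower_semicontinuous \<phi>"
    and inf_finite: "(INF y. F y + \<phi> y) > - \<infinity>"
    and F_loc_lip: "\<And>y. y \<in> interior (edom F) \<Longrightarrow>
          locally_lipschitz_at (edom F) (\<lambda>z. real_of_ereal (F z)) y"
    and dom_convex: "convex (edom F)"
    and dom_subset: "edom \<phi> \<subseteq> interior (edom F)"
    and phi_prox_bounded: "prox_bounded \<phi> \<gamma>\<^sub>\<phi>"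
    and x_dom: "x \<in> edom \<phi>"
  shows "((\<forall>y\<in>interior (edom F). lower_regular_at F y) \<and>
          (\<forall>y\<in>edom \<phi>. prox_regular_at \<phi> y) \<longrightarrow>
            (frechet_stationary F \<phi> x \<longleftrightarrow> critical_point \<gamma>\<^sub>\<phi> F \<phi> x) \<and>
            (critical_point \<gamma>\<^sub>\<phi> F \<phi> x \<longleftrightarrow>
              (\<exists>\<gamma>'::real. 0 < \<gamma>' \<and> ereal \<gamma>' < \<gamma>\<^sub>\<phi> \<and>
                (\<forall>\<gamma>\<in>{0<..\<gamma>'}. stationarity_measure \<gamma> F \<phi> x = 0))))
       \<and>
         ((\<forall>y\<in>interior (edom F). (\<lambda>z. real_of_ereal (F z)) differentiable (at y)) \<and>
          (\<forall>y\<in>interior (edom F).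
             locally_lipschitz_at (interior (edom F)) (gradient (\<lambda>z. real_of_ereal (F z))) y) \<longrightarrow>
            (proximal_stationary F \<phi> x \<longleftrightarrow> critical_point \<gamma>\<^sub>\<phi> F \<phi> x) \<and>
            (critical_point \<gamma>\<^sub>\<phi> F \<phi> x \<longleftrightarrow>
              (\<exists>\<gamma>'::real. 0 < \<gamma>' \<and> ereal \<gamma>' < \<gamma>\<^sub>\<phi> \<and>
                (\<forall>\<gamma>\<in>{0<..\<gamma>'}. stationarity_measure \<gamma> F \<phi> x = 0))))"
proof -
  \<comment> \<open>Outside \<open>edom F\<close> this takes the default value \<open>0\<close> of
    \<open>real_of_ereal\<close>; \<open>f\<close> represents \<open>F\<close> only inside.\<close>
  define f where "f = (\<lambda>z. real_of_ereal (F z))"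
  define V where "V = interior (edom F)"
  have V: "open V" "x \<in> V" using dom_subset x_dom by (auto simp: V_def)
  have F: "F y = ereal (f y)" if "y \<in> edom F" for y
    using that F_range[of y] by (cases "F y") (auto simp: edom_def f_def)
  then have F_V: "F y = ereal (f y)" if "y \<in> V" for y
    using that interior_subset by (auto simp: V_def)
  obtain s where s: "\<phi> x = ereal s"
    using x_dom phi_range[of x] by (cases "\<phi> x") (auto simp: edom_def)
  obtain U L where U: "open U" "x \<in> U" "U \<subseteq> edom F" "L-lipschitz_on U f"
    using F_loc_lip V(2) unfolding locally_lipschitz_at_def V_def f_def by blast
  have F_U: "F y = ereal (f y)" if "y \<in> U" for y using F U(3) that by blast
  have "limiting_subdiff F x \<subseteq> cball 0 L"
    using norm_limiting_subdiff_le_lipschitz[OF U(1,2,4) F_U] by auto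
  then have bounded: "bounded (limiting_subdiff F x)"
    using bounded_cball bounded_subset by blast
  note crit = critical_point_iff[OF phi_lsc phi_range bounded phi_prox_bounded x_dom]
  \<comment> \<open>Forward, the critical step size itself serves as \<open>\<gamma>'\<close>;
    backward, \<open>\<gamma>'\<close> belongs to the interval.\<close>
  have all_small: "critical_point \<gamma>\<^sub>\<phi> F \<phi> x \<longleftrightarrow>
      (\<exists>\<gamma>'::real. 0 < \<gamma>' \<and> ereal \<gamma>' < \<gamma>\<^sub>\<phi> \<and> (\<forall>\<gamma>\<in>{0<..\<gamma>'}. stationarity_measure \<gamma> F \<phi> x = 0))"
    unfolding critical_point_def
    using stationarity_measure_eq_0_antimono[OF phi_lsc phi_range bounded x_dom]
    by (metis greaterThanAtMost_iff order_refl)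
  have a: "frechet_stationary F \<phi> x \<longleftrightarrow> critical_point \<gamma>\<^sub>\<phi> F \<phi> x"
    if lower_reg: "\<forall>y\<in>interior (edom F). lower_regular_at F y"
      and prox_reg: "\<forall>y\<in>edom \<phi>. prox_regular_at \<phi> y"
  proof
    assume "frechet_stationary F \<phi> x"
    then obtain v where "v \<in> limiting_subdiff F x" "- v \<in> limiting_subdiff \<phi> x"
      using limiting_sum_rule[OF U(1,2,4) F_U phi_lsc phi_range x_dom]
      unfolding frechet_stationary_def by blast
    \<comment> \<open>Prox-regularity promotes the limiting subgradient \<open>- v\<close> of
      \<open>\<phi>\<close> to a proximal one.\<close>
    then show "critical_point \<gamma>\<^sub>\<phi> F \<phi> x"
      using crit prox_regular_imp_proximal_subdiff[of \<phi>, OF _ s] prox_reg x_dom by blast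
  next
    assume "critical_point \<gamma>\<^sub>\<phi> F \<phi> x"
    then obtain v where v: "v \<in> limiting_subdiff F x" "- v \<in> proximal_subdiff \<phi> x"
      using crit by blast
    \<comment> \<open>Lower regularity promotes \<open>v\<close> from limiting to Frechet, where
      subgradients of the summands simply add.\<close>
    have "v \<in> frechet_subdiff F x"
      using v(1) lower_reg V(2) by (simp add: lower_regular_at_def V_def)
    moreover have "- v \<in> frechet_subdiff \<phi> x"
      using v(2) proximal_subdiff_subset_frechet[of \<phi>, OF s] by blast
    ultimately have "v + - v \<in> frechet_subdiff (\<lambda>y. F y + \<phi> y) x"
      by (rule frechet_subdiff_add[of F, OF F_U[OF U(2)], of \<phi>, OF s])
    then show "frechet_stationary F \<phi> x"
      using x_dom by (simp add: frechet_stationary_def)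
  qed
  have b: "proximal_stationary F \<phi> x \<longleftrightarrow> critical_point \<gamma>\<^sub>\<phi> F \<phi> x"
    if diff: "\<forall>y\<in>interior (edom F). (\<lambda>z. real_of_ereal (F z)) differentiable (at y)"
      and lip: "\<forall>y\<in>interior (edom F).
        locally_lipschitz_at (interior (edom F)) (gradient (\<lambda>z. real_of_ereal (F z))) y"
  proof -
    have diff: "f differentiable (at y)" and lip: "locally_lipschitz_at V (gradient f) y"
      if "y \<in> V" for y
      using diff lip that by (simp_all add: f_def V_def)
    \<comment> \<open>With the gradient as the only multiplier, criticality says that
      \<open>- gradient f x\<close> is a proximal subgradient of \<open>\<phi>\<close>, which is the
      sum rule at \<open>0\<close>.\<close>
    have "limiting_subdiff F x = {gradient f x}"
      by (rule limiting_subdiff_eq_gradient[OF V diff lip F_V])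
    moreover have "0 \<in> proximal_subdiff (\<lambda>y. F y + \<phi> y) x \<longleftrightarrow> 0 - gradient f x \<in> proximal_subdiff \<phi> x"
      by (rule proximal_subdiff_gradient_add_iff[OF V diff lip[OF V(2)] F_V, of \<phi>, OF _ _ s])
    ultimately show ?thesis
      unfolding crit proximal_stationary_def using x_dom by simp
  qed
  show ?thesis using a b all_small by blast
qed

end
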